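(* Let $G$ be a Polish group whose universal minimal flow $M(G)$ is metrizable. Then $M(G)$ has a comeagre orbit, i.e., there is $x \in M(G)$ such that the orbit $G \cdot x$ is a comeagre subset of $M(G)$.
   Context: A Polish group is a separable, completely metrizable topological group. A $G$-flow is a continuous action of a topological group $G$ on a compact Hausdorff space; it is minimal if all of its orbits are dense. The universal minimal flow $M(G)$ of $G$ is the (unique up to isomorphism) minimal $G$-flow that maps continuously and $G$-equivariantly onto every minimal $G$-flow. *)

theory Defs
  imports "HOL-Analysis.Analysis" "HOL-Algebra.Group_Action"
begin

locale topological_group = group G for G (structure) +
  fixes T
  assumes topspace_eq: "topspace T = carrier G"
    and continuous_mult: "continuous_map (prod_topology T T) T (\<lambda>(g, h). g \<otimes> h)"
    and continuous_inv: "continuous_map T T (\<lambda>g. inv g)"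

locale Polish_group = topological_group +
  assumes separable: "separable_space T"
    and completely_metrizable: "completely_metrizable_space T"

locale G_flow = topological_group G T + group_action G "topspace X" \<phi>
  for G (structure) and T and X :: "'x topology" and \<phi> +
  assumes continuous_action: "continuous_map (prod_topology T X) X (\<lambda>(g, x). \<phi> g x)"
    and compact: "compact_space X"
    and Hausdorff: "Hausdorff_space X"

text \<open>The empty flow is excluded: with it no flow could map onto every minimal flow.\<close>

locale minimal_G_flow = G_flow +
  assumes nonempty: "topspace X \<noteq> {}"
    and dense_orbits: "x \<in> topspace X \<Longrightarrow> X closure_of (orbit G \<phi> x) = topspace X"

definition G_factor_map ::
  "('g, 'c) monoid_scheme \<Rightarrow> 'x topology \<Rightarrow> ('g \<Rightarrow> 'x \<Rightarrow> 'x) \<Rightarrow>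
   'y topology \<Rightarrow> ('g \<Rightarrow> 'y \<Rightarrow> 'y) \<Rightarrow> ('x \<Rightarrow> 'y) \<Rightarrow> bool"
  where "G_factor_map G X \<phi> Y \<psi> f \<longleftrightarrow>
    continuous_map X Y f \<and> f ` topspace X = topspace Y \<and>
    (\<forall>g\<in>carrier G. \<forall>x\<in>topspace X. f (\<phi> g x) = \<psi> g (f x))"

text \<open>
  A formula cannot quantify over flows living on arbitrary types, so the target flows
  below have their points in the type \<^typ>\<open>'g set set\<close>.  This loses nothing: a minimal
  flow is Hausdorff and has a dense subset indexed by the group, so it is isomorphic to one
  of these.  Theorem \<open>universal_minimal_flow_maps_onto\<close> at the end derives the
  universal property for target flows on an arbitrary type.
\<close>

definition universal_minimal_flow ::
  "('g, 'c) monoid_scheme \<Rightarrow> 'g topology \<Rightarrow> 'x topology \<Rightarrow> ('g \<Rightarrow> 'x \<Rightarrow> 'x) \<Rightarrow> bool"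
  where "universal_minimal_flow G T X \<phi> \<longleftrightarrow>
    minimal_G_flow G T X \<phi> \<and>
    (\<forall>(Y :: 'g set set topology) \<psi>.
       minimal_G_flow G T Y \<psi> \<longrightarrow> (\<exists>f. G_factor_map G X \<phi> Y \<psi> f))"

definition nowhere_dense_in :: "'a topology \<Rightarrow> 'a set \<Rightarrow> bool"
  where "nowhere_dense_in X A \<longleftrightarrow>
    A \<subseteq> topspace X \<and> X interior_of (X closure_of A) = {}"

definition meagre_in :: "'a topology \<Rightarrow> 'a set \<Rightarrow> bool"
  where "meagre_in X A \<longleftrightarrow>
    (\<exists>\<N>. countable \<N> \<and> (\<forall>N\<in>\<N>. nowhere_dense_in X N) \<and> A = \<Union>\<N>)"

definition comeagre_in :: "'a topology \<Rightarrow> 'a set \<Rightarrow> bool"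
  where "comeagre_in X A \<longleftrightarrow> A \<subseteq> topspace X \<and> meagre_in X (topspace X - A)"

lemma minimal_G_flow_transfer:
  fixes Y :: "'y topology" and e :: "'y \<Rightarrow> 'z"
  assumes flow: "minimal_G_flow G T Y \<psi>" and inj: "inj_on e (topspace Y)"
  obtains Z \<theta> where "minimal_G_flow G T Z \<theta>" and "homeomorphic_map Y Z e"
    and "\<And>g y. g \<in> carrier G \<Longrightarrow> y \<in> topspace Y \<Longrightarrow> e (\<psi> g y) = \<theta> g (e y)"
proof -
  interpret Y: minimal_G_flow G T Y \<psi> by fact
  define d where "d = inv_into (topspace Y) e"
  define E where "E = e ` topspace Y"
  define Z where "Z = pullback_topology E d Y"
  define \<theta> where "\<theta> = (\<lambda>g. \<lambda>z\<in>E. e (\<psi> g (d z)))"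
  have de: "d (e y) = y" if "y \<in> topspace Y" for y
    using that inj by (simp add: d_def)
  have ed: "e (d z) = z" "d z \<in> topspace Y" if "z \<in> E" for z
    using that by (auto simp: d_def E_def f_inv_into_f inv_into_into)
  have topZ: "topspace Z = E"
    using ed by (auto simp: Z_def topspace_pullback_topology)
  have cd: "continuous_map Z Y d"
    unfolding Z_def by (metis continuous_map_id continuous_map_pullback comp_id id_comp)
  have ce: "continuous_map Y Z e"
    unfolding Z_def
  proof (rule continuous_map_pullback')
    show "continuous_map Y Y (d \<circ> e)"
      by (rule continuous_map_eq[OF continuous_map_id]) (simp add: de)
    show "topspace Y \<subseteq> e -` E" by (auto simp: E_def)
  qed
  have hom: "homeomorphic_maps Y Z e d"
    using cd ce de ed topZ by (simp add: homeomorphic_maps_def)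
  then have hmap: "homeomorphic_map Y Z e"
    by (auto simp: homeomorphic_map_maps)
  have cl: "\<psi> g y \<in> topspace Y" if "g \<in> carrier G" "y \<in> topspace Y" for g y
    using Y.element_image that by blast
  have eq: "e (\<psi> g y) = \<theta> g (e y)" if "g \<in> carrier G" "y \<in> topspace Y" for g y
    using that by (simp add: \<theta>_def E_def de)
  have bij: "\<theta> g \<in> Bij E" if g: "g \<in> carrier G" for g
  proof -
    have b1: "bij_betw d E (topspace Y)" unfolding d_def E_def
      using inj by (simp add: bij_betw_inv_into inj_on_imp_bij_betw)
    have b2: "bij_betw (\<psi> g) (topspace Y) (topspace Y)"
      using Y.bij_prop0[OF g] by (simp add: Bij_def)
    have b3: "bij_betw e (topspace Y) E" using inj by (simp add: E_def inj_on_imp_bij_betw)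
    have "bij_betw (e \<circ> (\<psi> g \<circ> d)) E E"
      using bij_betw_trans[OF bij_betw_trans[OF b1 b2] b3] .
    then have "bij_betw (\<theta> g) E E"
      by (rule bij_betw_cong[THEN iffD1, rotated]) (simp add: \<theta>_def)
    then show ?thesis by (simp add: Bij_def \<theta>_def)
  qed
  have act: "group_action G (topspace Z) \<theta>"
    unfolding group_action_def group_hom_def group_hom_axioms_def topZ
  proof (intro conjI)
    show "group G" by (rule Y.is_group)
    show "group (BijGroup E)" by (rule group_BijGroup)
    show "\<theta> \<in> hom G (BijGroup E)"
    proof (rule homI)
      show "\<theta> g \<in> carrier (BijGroup E)" if "g \<in> carrier G" for g
        using bij[OF that] by (simp add: BijGroup_def)
      fix g h assume g: "g \<in> carrier G" and h: "h \<in> carrier G"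
      have "\<theta> (g \<otimes>\<^bsub>G\<^esub> h) = compose E (\<theta> g) (\<theta> h)"
      proof
        fix z show "\<theta> (g \<otimes>\<^bsub>G\<^esub> h) z = compose E (\<theta> g) (\<theta> h) z"
        proof (cases "z \<in> E")
          case True
          then show ?thesis
            using g h by (simp add: \<theta>_def compose_def ed cl de E_def Y.composition_rule)
        qed (simp add: \<theta>_def compose_def)
      qed
      then show "\<theta> (g \<otimes>\<^bsub>G\<^esub> h) = \<theta> g \<otimes>\<^bsub>BijGroup E\<^esub> \<theta> h"
        using bij g h by (simp add: BijGroup_def)
    qed
  qed
  have cont: "continuous_map (prod_topology T Z) Z (\<lambda>(g, z). \<theta> g z)"
  proof -
    have "continuous_map (prod_topology T Z) (prod_topology T Y) (\<lambda>(g, z). (g, d z))"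
      using cd continuous_map_prod_top[of T Z T Y "\<lambda>g. g" d] by simp
    from continuous_map_compose[OF continuous_map_compose[OF this Y.continuous_action] ce]
    show ?thesis
      by (rule continuous_map_eq) (auto simp: \<theta>_def topZ)
  qed
  have dense: "Z closure_of (orbit G \<theta> z) = topspace Z" if z: "z \<in> topspace Z" for z
  proof -
    have dz: "d z \<in> topspace Y" using z ed topZ by simp
    have "orbit G \<theta> z = e ` orbit G \<psi> (d z)"
      using z by (auto simp: orbit_def \<theta>_def topZ)
    moreover have "orbit G \<psi> (d z) \<subseteq> topspace Y"
      using cl dz by (auto simp: orbit_def)
    ultimately have "Z closure_of (orbit G \<theta> z) = e ` (Y closure_of orbit G \<psi> (d z))"
      using homeomorphic_map_closure_of[OF hmap] by simp
    then show ?thesis using Y.dense_orbits[OF dz] by (simp add: topZ E_def)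
  qed
  have "minimal_G_flow G T Z \<theta>"
  proof (intro minimal_G_flow.intro G_flow.intro act G_flow_axioms.intro
      minimal_G_flow_axioms.intro cont dense)
    show "topological_group G T" by (rule Y.topological_group_axioms)
    have "Y homeomorphic_space Z" using hom homeomorphic_space_def by blast
    then show "compact_space Z" "Hausdorff_space Z"
      using Y.compact Y.Hausdorff homeomorphic_compact_space homeomorphic_Hausdorff_space
      by blast+
    show "topspace Z \<noteq> {}" using Y.nonempty by (simp add: topZ E_def)
  qed
  then show thesis using that hmap eq by blast
qed

theorem universal_minimal_flow_maps_onto:
  fixes Y :: "'y topology"
  assumes X: "universal_minimal_flow (G :: ('g, 'c) monoid_scheme) T X \<phi>"
    and Y: "minimal_G_flow G T Y \<psi>"
  shows "\<exists>f. G_factor_map G X \<phi> Y \<psi> f"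
proof -
  interpret Y: minimal_G_flow G T Y \<psi> by fact
  obtain y0 where y0: "y0 \<in> topspace Y" using Y.nonempty by blast
  define e :: "'y \<Rightarrow> 'g set set" where
    "e = (\<lambda>y. {A. A \<subseteq> carrier G \<and> y \<in> Y closure_of ((\<lambda>g. \<psi> g y0) ` A)})"
  have "inj_on e (topspace Y)"
  proof (rule inj_onI, rule ccontr)
    fix y z assume y: "y \<in> topspace Y" and z: "z \<in> topspace Y" and e: "e y = e z" and "y \<noteq> z"
    then obtain U V where U: "openin Y U" "y \<in> U" and V: "openin Y V" "z \<in> V"
      and disj: "disjnt U V"
      using Y.Hausdorff unfolding Hausdorff_space_def by metis
    define A where "A = {g \<in> carrier G. \<psi> g y0 \<in> U}"
    have "A \<in> e y"
      unfolding e_def mem_Collect_eq in_closure_of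
    proof (intro conjI allI impI y)
      show "A \<subseteq> carrier G" by (auto simp: A_def)
      fix W assume "y \<in> W \<and> openin Y W"
      then have W: "openin Y (U \<inter> W)" "y \<in> U \<inter> W" using U by auto
      have "y \<in> Y closure_of orbit G \<psi> y0" using Y.dense_orbits[OF y0] y by simp
      then obtain w where "w \<in> orbit G \<psi> y0" "w \<in> U \<inter> W"
        using W unfolding in_closure_of by blast
      then show "\<exists>w. w \<in> (\<lambda>g. \<psi> g y0) ` A \<and> w \<in> W"
        by (auto simp: orbit_def A_def)
    qed
    moreover have "A \<notin> e z"
      using V disj unfolding e_def in_closure_of A_def disjnt_def by blast
    ultimately show False using e by simp
  qed
  then obtain Z \<theta> where Z: "minimal_G_flow G T Z \<theta>" and hom: "homeomorphic_map Y Z e"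
    and eq: "\<And>g y. g \<in> carrier G \<Longrightarrow> y \<in> topspace Y \<Longrightarrow> e (\<psi> g y) = \<theta> g (e y)"
    using minimal_G_flow_transfer[OF Y] by metis
  obtain f where f: "G_factor_map G X \<phi> Z \<theta> f"
    using X Z unfolding universal_minimal_flow_def by blast
  obtain d where d: "homeomorphic_maps Y Z e d"
    using hom by (auto simp: homeomorphic_map_maps)
  have dZ: "d ` topspace Z = topspace Y"
    using d homeomorphic_imp_surjective_map homeomorphic_maps_map by metis
  have "d (f (\<phi> g x)) = \<psi> g (d (f x))" if g: "g \<in> carrier G" and x: "x \<in> topspace X" for g x
  proof -
    have fx: "f x \<in> topspace Z" using f x by (auto simp: G_factor_map_def)
    have dfx: "d (f x) \<in> topspace Y" using fx dZ by blast
    have "d (f (\<phi> g x)) = d (\<theta> g (e (d (f x))))"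
      using f g x fx d by (simp add: G_factor_map_def homeomorphic_maps_def)
    also have "\<dots> = d (e (\<psi> g (d (f x))))" using eq[OF g dfx] by simp
    also have "\<dots> = \<psi> g (d (f x))"
      using d Y.element_image[OF g dfx refl] by (simp add: homeomorphic_maps_def)
    finally show ?thesis .
  qed
  moreover have "continuous_map X Y (d \<circ> f)"
    using f d by (auto simp: G_factor_map_def homeomorphic_maps_def intro: continuous_map_compose)
  moreover have "(d \<circ> f) ` topspace X = topspace Y"
    using f dZ by (simp add: G_factor_map_def flip: image_image)
  ultimately have "G_factor_map G X \<phi> Y \<psi> (d \<circ> f)"
    by (simp add: G_factor_map_def)
  then show ?thesis by blast
qed

end

theory Submission
  imports Defs
begin

text \<open>
  Call an open set \<open>W\<close> recurrent for a neighbourhood \<open>V\<close> of the identity if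
  \<open>V W1\<close> meets \<open>W2\<close> for all nonempty open \<open>W1, W2\<close> inside \<open>W\<close>.

  If every nonempty open set contains a nonempty recurrent one, for each \<open>V\<close>, then generic points
  \<open>x\<close> lie in the interior of the closure of \<open>V x\<close> for all \<open>V\<close>, and a back-and-forth argument in
  the complete group puts any two such points in the same orbit.

  Otherwise there are \<open>V\<close> and nonempty open sets \<open>S 0, S 1, \<dots>\<close> with \<open>V (S m)\<close> disjoint from \<open>S n\<close>
  for \<open>m < n\<close>.  With a length function on the group whose unit ball lies in \<open>V\<close> one builds an
  extension of the flow carrying, for every set \<open>A\<close> of naturals, a continuous function that is \<open>1\<close>
  over \<open>S n\<close> if \<open>n \<in> A\<close> and \<open>0\<close> over \<open>S n\<close> otherwise.  A minimal subflow of the extension is a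
  factor of the universal flow \<open>M\<close>; points \<open>q n\<close> of \<open>M\<close> mapped over \<open>S n\<close> then have no
  convergent subsequence, because for a suitable \<open>A\<close> the function alternates between \<open>1\<close> and \<open>0\<close>
  along it.  So \<open>M\<close> is not metrizable.
\<close>

section \<open>Length functions on topological groups\<close>

text \<open>Cut at the first entry \<open>z\<close> whose tail \<open>zs\<close> weighs less than
  \<open>c\<close>. If \<open>ys\<close> is nonempty, then \<open>z # zs\<close> weighs at least
  \<open>c\<close>, which leaves less than \<open>a\<close> for \<open>ys\<close>. This split drives
  the Birkhoff-Kakutani chain argument below.\<close>

lemma list_split_sum_less:
  fixes w :: "'a \<Rightarrow> real"
  assumes "xs \<noteq> []" and "a > 0" and "\<And>x. w x \<ge> 0" and "sum_list (map w xs) < a + c"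
    and "c > 0"
  shows "\<exists>ys z zs. xs = ys @ z # zs \<and> sum_list (map w ys) < a \<and> sum_list (map w zs) < c"
  using assms(1,2,4)
proof (induction xs arbitrary: a)
  case (Cons x xs)
  show ?case
  proof (cases "sum_list (map w xs) < c")
    case True
    then show ?thesis using Cons.prems by (intro exI[of _ "[]"]) auto
  next
    case False
    then have "xs \<noteq> []" using \<open>c > 0\<close> by auto
    moreover have "a - w x > 0" "sum_list (map w xs) < (a - w x) + c"
      using False Cons.prems by auto
    ultimately obtain ys z zs where "xs = ys @ z # zs" "sum_list (map w ys) < a - w x"
      "sum_list (map w zs) < c"
      using Cons.IH by blast
    then show ?thesis by (intro exI[of _ "x # ys"]) auto
  qed
qed simp

context topological_group
begin

lemma in_carrier_if_openin: "openin T V \<Longrightarrow> g \<in> V \<Longrightarrow> g \<in> carrier G"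
  using openin_subset topspace_eq by blast

lemma continuous_map_translation_left:
  assumes "g \<in> carrier G"
  shows "continuous_map T T (\<lambda>h. g \<otimes> h)"
proof -
  have "continuous_map T (prod_topology T T) (\<lambda>h. (g, h))"
    using assms by (simp add: continuous_map_pairedI topspace_eq)
  from continuous_map_compose[OF this continuous_mult] show ?thesis by (simp add: o_def)
qed

lemma continuous_map_translation_right:
  assumes "g \<in> carrier G"
  shows "continuous_map T T (\<lambda>h. h \<otimes> g)"
proof -
  have "continuous_map T (prod_topology T T) (\<lambda>h. (h, g))"
    using assms by (simp add: continuous_map_pairedI topspace_eq)
  from continuous_map_compose[OF this continuous_mult] show ?thesis by (simp add: o_def)
qed

lemma neighbourhood_mult2:
  assumes "openin T V" and "\<one> \<in> V"
  obtains W where "openin T W" "\<one> \<in> W" "\<And>a b. a \<in> W \<Longrightarrow> b \<in> W \<Longrightarrow> a \<otimes> b \<in> V"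
proof -
  let ?P = "{p \<in> topspace (prod_topology T T). (\<lambda>(g, h). g \<otimes> h) p \<in> V}"
  have "openin (prod_topology T T) ?P"
    using openin_continuous_map_preimage[OF continuous_mult assms(1)] .
  moreover have "(\<one>, \<one>) \<in> ?P" using assms by (simp add: topspace_eq)
  ultimately obtain A B where "openin T A" "openin T B" "\<one> \<in> A" "\<one> \<in> B" "A \<times> B \<subseteq> ?P"
    unfolding openin_prod_topology_alt by meson
  then show thesis by (intro that[of "A \<inter> B"]) auto
qed

lemma neighbourhood_mult3:
  assumes "openin T V" and "\<one> \<in> V"
  obtains W where "openin T W" "\<one> \<in> W"
    "\<And>a b c. a \<in> W \<Longrightarrow> b \<in> W \<Longrightarrow> c \<in> W \<Longrightarrow> a \<otimes> b \<otimes> c \<in> V"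
proof -
  obtain W1 where W1: "openin T W1" "\<one> \<in> W1" "\<And>a b. a \<in> W1 \<Longrightarrow> b \<in> W1 \<Longrightarrow> a \<otimes> b \<in> V"
    using neighbourhood_mult2[OF assms] by blast
  obtain W2 where W2: "openin T W2" "\<one> \<in> W2" "\<And>a b. a \<in> W2 \<Longrightarrow> b \<in> W2 \<Longrightarrow> a \<otimes> b \<in> W1"
    using neighbourhood_mult2[OF W1(1,2)] by blast
  show thesis
    using W1 W2 by (intro that[of "W1 \<inter> W2"]) auto
qed

text \<open>\<open>U 0\<close> is the whole group, so that every element is a product of factors
  from the sequence. Triple products match the three-part splitting of a chain. The sets are not
  made symmetric; the length function is symmetrised at the end instead.\<close>

lemma neighbourhood_sequence:
  assumes "openin T V" and "\<one> \<in> V"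
  obtains U :: "nat \<Rightarrow> 'a set" where "\<And>n. openin T (U n)" "\<And>n. \<one> \<in> U n"
    "U 0 = carrier G" "U 1 \<subseteq> V"
    "\<And>(n::nat) a b c. a \<in> U (Suc n) \<Longrightarrow> b \<in> U (Suc n) \<Longrightarrow> c \<in> U (Suc n) \<Longrightarrow> a \<otimes> b \<otimes> c \<in> U n"
proof -
  let ?P = "\<lambda>(n::nat) W. openin T W \<and> \<one> \<in> W \<and> (if n = 0 then W = carrier G else W \<subseteq> V)"
  let ?Q = "\<lambda>(n::nat) W W'. \<forall>a\<in>W'. \<forall>b\<in>W'. \<forall>c\<in>W'. a \<otimes> b \<otimes> c \<in> W"
  have "\<exists>U. \<forall>n. ?P n (U n) \<and> ?Q n (U n) (U (Suc n))"
  proof (rule dependent_nat_choice)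
    have "openin T (carrier G)" using openin_topspace[of T] by (simp add: topspace_eq)
    then show "\<exists>W. ?P 0 W" by auto
  next
    fix W n assume W: "?P n W"
    then obtain W' where "openin T W'" "\<one> \<in> W'"
      "\<And>a b c. a \<in> W' \<Longrightarrow> b \<in> W' \<Longrightarrow> c \<in> W' \<Longrightarrow> a \<otimes> b \<otimes> c \<in> W"
      using neighbourhood_mult3[of W] by blast
    then show "\<exists>W'. ?P (Suc n) W' \<and> ?Q n W W'"
      using assms by (intro exI[of _ "W' \<inter> V"]) auto
  qed
  then obtain U where "\<forall>n. ?P n (U n) \<and> ?Q n (U n) (U (Suc n))" ..
  then have PQ: "?P n (U n) \<and> ?Q n (U n) (U (Suc n))" for n by (rule spec)
  note U = PQ[THEN conjunct1] PQ[THEN conjunct2]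
  show thesis
  proof (rule that[of U])
    show "openin T (U n)" "\<one> \<in> U n" for n using U(1)[of n] by blast+
    show "U 0 = carrier G" "U 1 \<subseteq> V" using U(1)[of 0] U(1)[of 1] by simp_all
    show "a \<otimes> b \<otimes> c \<in> U n"
      if "a \<in> U (Suc n)" "b \<in> U (Suc n)" "c \<in> U (Suc n)" for n a b c
      using U(2)[of n] that by blast
  qed
qed

text \<open>An entry \<open>(g, n)\<close> stands for a factor \<open>g\<close> drawn from the
  neighbourhood \<open>U n\<close>, at cost \<open>(1/2) ^ n\<close>. The list is a chain, and the
  infimum of the costs of chains with a given product becomes the length of that product.\<close>

definition weighted_prod :: "('a \<times> nat) list \<Rightarrow> 'a"
  where "weighted_prod xs = foldr (\<lambda>p h. fst p \<otimes> h) xs \<one>"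

definition weight :: "('a \<times> nat) list \<Rightarrow> real"
  where "weight xs = (\<Sum>p\<leftarrow>xs. (1/2) ^ snd p)"

lemma weight_nonneg: "weight xs \<ge> 0"
  by (auto simp: weight_def intro!: sum_list_nonneg)

lemma weighted_prod_closed:
  "fst ` set xs \<subseteq> carrier G \<Longrightarrow> weighted_prod xs \<in> carrier G"
  by (induction xs) (auto simp: weighted_prod_def)

lemma weighted_prod_Cons: "weighted_prod (p # xs) = fst p \<otimes> weighted_prod xs"
  by (simp add: weighted_prod_def)

lemma weighted_prod_append:
  assumes "fst ` set xs \<subseteq> carrier G" and "fst ` set ys \<subseteq> carrier G"
  shows "weighted_prod (xs @ ys) = weighted_prod xs \<otimes> weighted_prod ys"
  using assms
proof (induction xs)
  case Nil
  then show ?case using weighted_prod_closed[of ys] by (simp add: weighted_prod_def[of "[]"])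
next
  case (Cons p xs)
  then show ?case
    using weighted_prod_closed[of xs] weighted_prod_closed[of ys]
    by (simp add: weighted_prod_Cons m_assoc)
qed

text \<open>Induction on the length: split the chain as \<open>ys @ z # zs\<close> with both outer
  parts of weight below \<open>(1/2) ^ Suc m\<close>. Their products lie in \<open>U (Suc m)\<close>
  by induction. The strict bound on the total weight forces \<open>snd z > m\<close>, so the middle
  factor lies in \<open>U (Suc m)\<close> as well, and the triple product falls into
  \<open>U m\<close>.\<close>

lemma weighted_prod_in_neighbourhood:
  assumes op: "\<And>n::nat. openin T (U n)" and one: "\<And>n. \<one> \<in> U n"
    and mult: "\<And>n a b c. a \<in> U (Suc n) \<Longrightarrow> b \<in> U (Suc n) \<Longrightarrow> c \<in> U (Suc n) \<Longrightarrow> a \<otimes> b \<otimes> c \<in> U n"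
    and "\<And>p. p \<in> set xs \<Longrightarrow> fst p \<in> U (snd p)" and "weight xs < (1/2) ^ m"
  shows "weighted_prod xs \<in> U m"
  using assms(4,5)
proof (induction xs arbitrary: m rule: length_induct)
  case (1 xs)
  have "U (Suc n) \<subseteq> U n" for n
  proof
    fix g assume g: "g \<in> U (Suc n)"
    then have "g \<otimes> \<one> \<otimes> \<one> \<in> U n" using one mult by blast
    then show "g \<in> U n" using in_carrier_if_openin[OF op g] by simp
  qed
  then have dec: "U n \<subseteq> U k" if "k \<le> n" for k n
    using lift_Suc_antimono_le[of U, OF _ that] by blast
  show ?case
  proof (cases "xs = []")
    case True
    then show ?thesis using one by (simp add: weighted_prod_def)
  next
    case False
    have "sum_list (map (\<lambda>p. (1/2) ^ snd p) xs) < (1/2) ^ Suc m + (1/2 :: real) ^ Suc m"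
      using 1 by (simp add: weight_def)
    from list_split_sum_less[OF False _ _ this]
    obtain ys z zs where xs: "xs = ys @ z # zs" and
      ys: "weight ys < (1/2) ^ Suc m" and zs: "weight zs < (1/2) ^ Suc m"
      unfolding weight_def by auto
    have "weighted_prod ys \<in> U (Suc m)"
      using "1.prems"(1) ys unfolding xs by (intro "1.IH"[rule_format]) (auto simp: xs)
    moreover have "weighted_prod zs \<in> U (Suc m)"
      using "1.prems"(1) zs unfolding xs by (intro "1.IH"[rule_format]) (auto simp: xs)
    moreover have "fst z \<in> U (Suc m)"
    proof -
      have "(1/2) ^ snd z \<le> weight xs"
        using weight_nonneg[of ys] weight_nonneg[of zs] unfolding xs weight_def by simp
      then have "(1/2 :: real) ^ snd z < (1/2) ^ m" using 1 by linarith
      then have "snd z > m" by (subst (asm) power_strict_decreasing_iff) auto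
      then show ?thesis using dec[of "Suc m" "snd z"] "1.prems"(1)[of z] unfolding xs by auto
    qed
    ultimately have "weighted_prod ys \<otimes> fst z \<otimes> weighted_prod zs \<in> U m"
      using mult by blast
    moreover have "weighted_prod xs = weighted_prod ys \<otimes> fst z \<otimes> weighted_prod zs"
    proof -
      have c: "fst ` set xs \<subseteq> carrier G"
        using "1.prems"(1) in_carrier_if_openin[OF op] by blast
      then have "fst ` set ys \<subseteq> carrier G" "fst ` set zs \<subseteq> carrier G" "fst z \<in> carrier G"
        unfolding xs by auto
      then show ?thesis
        using weighted_prod_closed[of ys] weighted_prod_closed[of zs] unfolding xs
        by (subst weighted_prod_append) (auto simp: weighted_prod_Cons m_assoc image_Un)
    qed
    ultimately show ?thesis by simp
  qed
qed

lemma Birkhoff_Kakutani_length_function: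
  assumes "openin T V" and "\<one> \<in> V"
  obtains \<rho> :: "'a \<Rightarrow> real" where "\<And>g. g \<in> carrier G \<Longrightarrow> 0 \<le> \<rho> g" "\<rho> \<one> = 0"
    "\<And>g h. g \<in> carrier G \<Longrightarrow> h \<in> carrier G \<Longrightarrow> \<rho> (g \<otimes> h) \<le> \<rho> g + \<rho> h"
    "\<And>g. g \<in> carrier G \<Longrightarrow> \<rho> (inv g) = \<rho> g"
    "\<And>e. e > 0 \<Longrightarrow> \<exists>W. openin T W \<and> \<one> \<in> W \<and> (\<forall>g\<in>W. \<rho> g < e)"
    "\<And>g. g \<in> carrier G \<Longrightarrow> \<rho> g < 1 \<Longrightarrow> g \<in> V"
proof -
  obtain U :: "nat \<Rightarrow> 'a set" where op: "\<And>n. openin T (U n)" and one: "\<And>n. \<one> \<in> U n"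
    and U0: "U 0 = carrier G" and U1: "U 1 \<subseteq> V"
    and mult: "\<And>n a b c. a \<in> U (Suc n) \<Longrightarrow> b \<in> U (Suc n) \<Longrightarrow> c \<in> U (Suc n) \<Longrightarrow> a \<otimes> b \<otimes> c \<in> U n"
    using neighbourhood_sequence[OF assms] by blast
  \<comment> \<open>\<open>L g\<close> collects the admissible chains with product \<open>g\<close>.
    Concatenating chains makes the infimum \<open>\<sigma>\<close> of their weights
    subadditive.\<close>
  define L where "L g = {xs. (\<forall>p\<in>set xs. fst p \<in> U (snd p)) \<and> weighted_prod xs = g}" for g
  define \<sigma> where "\<sigma> g = Inf (weight ` L g)" for g
  have bdd: "bdd_below (weight ` L g)" for g
    using weight_nonneg by (auto simp: bdd_below_def)
  have single: "[(g, n)] \<in> L g" if "g \<in> U n" for g n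
    using that in_carrier_if_openin[OF op that] unfolding L_def weighted_prod_def by simp
  have ne: "weight ` L g \<noteq> {}" if "g \<in> carrier G" for g
    using single[of g 0] that U0 by blast
  have Lc: "fst ` set xs \<subseteq> carrier G" if "xs \<in> L g" for xs g
    using that in_carrier_if_openin[OF op] unfolding L_def by blast
  have nonneg: "0 \<le> \<sigma> g" if "g \<in> carrier G" for g
    unfolding \<sigma>_def using ne[OF that] weight_nonneg by (intro cInf_greatest) auto
  have le: "\<sigma> g \<le> weight xs" if "xs \<in> L g" for g xs
    unfolding \<sigma>_def using that bdd by (intro cInf_lower) auto
  have "[] \<in> L \<one>" by (simp add: L_def weighted_prod_def)
  from le[OF this] have \<sigma>1: "\<sigma> \<one> = 0" using nonneg[of \<one>] by (simp add: weight_def)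
  have sub: "\<sigma> (g \<otimes> h) \<le> \<sigma> g + \<sigma> h" if gh: "g \<in> carrier G" "h \<in> carrier G" for g h
  proof (rule field_le_epsilon)
    fix e :: real assume "e > 0"
    obtain xs where xs: "xs \<in> L g" "weight xs < \<sigma> g + e / 2"
      using cInf_lessD[OF ne[OF gh(1)], of "\<sigma> g + e / 2"] \<open>e > 0\<close>
      unfolding \<sigma>_def[symmetric] by auto
    obtain ys where ys: "ys \<in> L h" "weight ys < \<sigma> h + e / 2"
      using cInf_lessD[OF ne[OF gh(2)], of "\<sigma> h + e / 2"] \<open>e > 0\<close>
      unfolding \<sigma>_def[symmetric] by auto
    have "xs @ ys \<in> L (g \<otimes> h)"
      using xs(1) ys(1) weighted_prod_append[OF Lc[OF xs(1)] Lc[OF ys(1)]] by (auto simp: L_def)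
    from le[OF this] show "\<sigma> (g \<otimes> h) \<le> \<sigma> g + \<sigma> h + e"
      using xs(2) ys(2) by (simp add: weight_def)
  qed
  have small: "\<sigma> g \<le> (1/2) ^ n" if "g \<in> U n" for g n
    using le[OF single[OF that]] by (simp add: weight_def)
  \<comment> \<open>The threshold 1/2 is \<open>(1/2) ^ 1\<close>: a chain cheaper than that has its
    product in \<open>U 1\<close>, which lies inside \<open>V\<close>.\<close>
  have V: "g \<in> V" if g: "g \<in> carrier G" and "\<sigma> g < 1/2" for g
  proof -
    obtain xs where xs: "xs \<in> L g" "weight xs < 1/2"
      using cInf_lessD[OF ne[OF g], of "1/2"] \<open>\<sigma> g < 1/2\<close> unfolding \<sigma>_def by blast
    have "weighted_prod xs \<in> U 1"
    proof (rule weighted_prod_in_neighbourhood[where U = U, OF op one mult])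
      show "fst p \<in> U (snd p)" if "p \<in> set xs" for p using xs that unfolding L_def by blast
    qed (use xs in simp_all)
    then show ?thesis using xs U1 unfolding L_def by blast
  qed
  show thesis
  \<comment> \<open>Adding \<open>\<sigma> (inv g)\<close> makes the length symmetric. The factor 2
    rescales the threshold 1/2 of \<open>\<sigma>\<close> to 1.\<close>
  proof (rule that[of "\<lambda>g. 2 * (\<sigma> g + \<sigma> (inv g))"])
    show "0 \<le> 2 * (\<sigma> g + \<sigma> (inv g))" if "g \<in> carrier G" for g
      using nonneg that by simp
    show "2 * (\<sigma> \<one> + \<sigma> (inv \<one>)) = 0" by (simp add: \<sigma>1)
    show "2 * (\<sigma> (g \<otimes> h) + \<sigma> (inv (g \<otimes> h)))
        \<le> 2 * (\<sigma> g + \<sigma> (inv g)) + 2 * (\<sigma> h + \<sigma> (inv h))"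
      if "g \<in> carrier G" "h \<in> carrier G" for g h
      using sub[OF that] sub[of "inv h" "inv g"] that by (simp add: inv_mult_group)
    show "2 * (\<sigma> (inv g) + \<sigma> (inv (inv g))) = 2 * (\<sigma> g + \<sigma> (inv g))" if "g \<in> carrier G" for g
      using that by simp
    show "\<exists>W. openin T W \<and> \<one> \<in> W \<and> (\<forall>g\<in>W. 2 * (\<sigma> g + \<sigma> (inv g)) < e)" if "e > 0" for e
    proof -
      \<comment> \<open>On \<open>?W\<close> both \<open>\<sigma> g\<close> and
        \<open>\<sigma> (inv g)\<close> are below \<open>e / 4\<close>, and the doubled sum stays
        below \<open>e\<close>.\<close>
      obtain n where n: "(1/2 :: real) ^ n < e / 4"
        using real_arch_pow_inv[of "e / 4" "1/2"] \<open>e > 0\<close> by auto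
      let ?W = "U n \<inter> {g \<in> topspace T. inv g \<in> U n}"
      have "openin T ?W"
        using op openin_continuous_map_preimage[OF continuous_inv] by blast
      moreover have "\<one> \<in> ?W" using one by (simp add: topspace_eq)
      moreover have "2 * (\<sigma> g + \<sigma> (inv g)) < e" if "g \<in> ?W" for g
        using small[of g n] small[of "inv g" n] that n by auto
      ultimately show ?thesis by blast
    qed
    show "g \<in> V" if "g \<in> carrier G" "2 * (\<sigma> g + \<sigma> (inv g)) < 1" for g
      using V[OF that(1)] nonneg[of "inv g"] that by simp
  qed
qed

end

section \<open>Points with locally somewhere dense orbits\<close>

text \<open>Total boundedness gives a finite net for each radius \<open>1 / Suc n\<close>; the balls
  of these radii around the net points form a countable base.\<close>

lemma compact_metrizable_imp_second_countable:
  assumes "compact_space X" and "metrizable_space X"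
  shows "second_countable X"
proof -
  obtain M d where "Metric_space M d" and X: "X = Metric_space.mtopology M d"
    using assms(2) by (auto simp: metrizable_space_def)
  interpret Metric_space M d by fact
  have "mtotally_bounded M"
    using assms(1) compactin_imp_mtotally_bounded by (simp add: X compact_space_def)
  then have "\<exists>F. finite F \<and> F \<subseteq> M \<and> M \<subseteq> (\<Union>x\<in>F. mball x (1 / Suc n))" for n
    by (simp add: mtotally_bounded_def)
  then obtain F where F: "\<And>n. finite (F n)" "\<And>n. F n \<subseteq> M" "\<And>n. M \<subseteq> (\<Union>x\<in>F n. mball x (1 / Suc n))"
    by metis
  define B where "B = (\<Union>n. (\<lambda>x. mball x (1 / Suc n)) ` F n)"
  have "\<exists>V\<in>B. x \<in> V \<and> V \<subseteq> U" if U: "openin mtopology U" and x: "x \<in> U" for U x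
  proof -
    obtain r where r: "r > 0" "mball x r \<subseteq> U" and xM: "x \<in> M"
      using U x unfolding openin_mtopology by blast
    obtain n where n: "1 / real (Suc n) < r / 2"
      using r(1) by (metis half_gt_zero nat_approx_posE)
    obtain a where a: "a \<in> F n" "x \<in> mball a (1 / Suc n)" using F(3)[of n] xM by auto
    have "mball a (1 / Suc n) \<subseteq> mball x r"
    proof
      fix y assume y: "y \<in> mball a (1 / Suc n)"
      then have "d x y \<le> d a x + d a y" using a(2) xM by (metis commute in_mball triangle)
      then show "y \<in> mball x r" using y a(2) n by auto
    qed
    then show ?thesis using a r(2) by (auto simp: B_def)
  qed
  moreover have "countable B" using F(1) by (auto simp: B_def countable_finite)
  moreover have "\<forall>V\<in>B. openin mtopology V" by (auto simp: B_def)
  ultimately show ?thesis unfolding second_countable_def X by blast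
qed

lemma (in Metric_space) MCauchy_if_dist_Suc_less_half_power:
  assumes "range f \<subseteq> M" and "\<And>n. d (f n) (f (Suc n)) < (1/2) ^ n"
  shows "MCauchy f"
proof -
  have f: "f n \<in> M" for n using assms(1) by auto
  \<comment> \<open>The right-hand side is the exact geometric sum; the subtracted term is what lets
    the induction on \<open>k\<close> close.\<close>
  have "d (f n) (f (n + k)) \<le> 2 * (1/2) ^ n - 2 * (1/2) ^ (n + k)" for n k
  proof (induction k)
    case (Suc k)
    have "d (f n) (f (n + Suc k)) \<le> d (f n) (f (n + k)) + d (f (n + k)) (f (Suc (n + k)))"
      using f triangle by simp
    then show ?case using Suc assms(2)[of "n + k"] by simp
  qed (use f in simp)
  then have le: "d (f n) (f m) \<le> 2 * (1/2) ^ n" if "n \<le> m" for n m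
  proof -
    have "d (f n) (f (n + (m - n))) \<le> 2 * (1/2) ^ n - 2 * (1/2) ^ (n + (m - n))" by fact
    also have "\<dots> \<le> 2 * (1/2) ^ n" by simp
    finally show ?thesis using that by simp
  qed
  show ?thesis
    unfolding MCauchy_def
  proof (intro conjI assms(1) allI impI)
    fix e :: real assume "e > 0"
    then obtain N where N: "(1/2 :: real) ^ N < e / 4"
      using real_arch_pow_inv[of "e / 4" "1/2"] by auto
    have "d (f n) (f m) < e" if "N \<le> n" "N \<le> m" for n m
    proof -
      have "d (f n) (f m) \<le> d (f N) (f n) + d (f N) (f m)" using f by (metis commute triangle)
      then show ?thesis using le[OF that(1)] le[OF that(2)] N by linarith
    qed
    then show "\<exists>N. \<forall>n m. N \<le> n \<longrightarrow> N \<le> m \<longrightarrow> d (f n) (f m) < e" by blast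
  qed
qed

section \<open>Local density of orbits and the back-and-forth step\<close>

context G_flow
begin

lemma action_closed [simp]: "g \<in> carrier G \<Longrightarrow> x \<in> topspace X \<Longrightarrow> \<phi> g x \<in> topspace X"
  using element_image by blast

lemma action_one [simp]: "x \<in> topspace X \<Longrightarrow> \<phi> \<one> x = x"
  by (simp flip: id_eq_one)

lemma action_inv [simp]:
  assumes "g \<in> carrier G" and "x \<in> topspace X"
  shows "\<phi> (inv g) (\<phi> g x) = x" and "\<phi> g (\<phi> (inv g) x) = x"
  using assms by (simp_all flip: composition_rule)

lemma continuous_map_action_point:
  assumes "x \<in> topspace X"
  shows "continuous_map T X (\<lambda>g. \<phi> g x)"
proof -
  have "continuous_map T (prod_topology T X) (\<lambda>g. (g, x))"
    using assms by (simp add: continuous_map_pairedI)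
  from continuous_map_compose[OF this continuous_action] show ?thesis by (simp add: o_def)
qed

lemma continuous_map_action:
  assumes "g \<in> carrier G"
  shows "continuous_map X X (\<phi> g)"
proof -
  have "continuous_map X (prod_topology T X) (\<lambda>x. (g, x))"
    using assms by (simp add: continuous_map_pairedI topspace_eq)
  from continuous_map_compose[OF this continuous_action] show ?thesis by (simp add: o_def)
qed

lemma homeomorphic_map_action:
  assumes "g \<in> carrier G"
  shows "homeomorphic_map X X (\<phi> g)"
proof -
  have "homeomorphic_maps X X (\<phi> g) (\<phi> (inv g))"
    using assms by (simp add: homeomorphic_maps_def continuous_map_action)
  then show ?thesis by (auto simp: homeomorphic_map_maps)
qed

text \<open>The condition is imposed at every \<open>g\<close> and not only at \<open>\<one>\<close>
  because the back-and-forth construction uses it around translates of \<open>x\<close>. The next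
  lemma reduces it to neighbourhoods of \<open>\<one>\<close>.\<close>

definition locally_somewhere_dense :: "'x \<Rightarrow> bool"
  where "locally_somewhere_dense x \<longleftrightarrow> x \<in> topspace X \<and>
    (\<forall>g U. openin T U \<and> g \<in> U \<longrightarrow>
      \<phi> g x \<in> X interior_of (X closure_of ((\<lambda>h. \<phi> h x) ` U)))"

text \<open>Translate \<open>U\<close> by the inverse of \<open>g\<close> to a neighbourhood of
  \<open>\<one>\<close>, then carry the conclusion back with the homeomorphism
  \<open>\<phi> g\<close>, which commutes with closure and interior.\<close>

lemma locally_somewhere_denseI:
  assumes x: "x \<in> topspace X"
    and one: "\<And>V. openin T V \<Longrightarrow> \<one> \<in> V \<Longrightarrow> x \<in> X interior_of (X closure_of ((\<lambda>h. \<phi> h x) ` V))"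
  shows "locally_somewhere_dense x"
  unfolding locally_somewhere_dense_def
proof (intro conjI x allI impI)
  fix g U assume gU: "openin T U \<and> g \<in> U"
  then have g: "g \<in> carrier G" using in_carrier_if_openin by blast
  have c: "continuous_map T T (\<lambda>h. g \<otimes> h)" by (rule continuous_map_translation_left[OF g])
  define V where "V = {h \<in> topspace T. g \<otimes> h \<in> U}"
  have V: "openin T V" "\<one> \<in> V"
    using openin_continuous_map_preimage[OF c] gU g by (auto simp: V_def topspace_eq)
  have Vx: "(\<lambda>h. \<phi> h x) ` V \<subseteq> topspace X" using x by (auto simp: V_def topspace_eq)
  have hom: "homeomorphic_map X X (\<phi> g)" by (rule homeomorphic_map_action[OF g])
  have "\<phi> g x \<in> \<phi> g ` (X interior_of (X closure_of ((\<lambda>h. \<phi> h x) ` V)))"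
    using one[OF V] by blast
  also have "\<dots> = X interior_of (X closure_of (\<phi> g ` (\<lambda>h. \<phi> h x) ` V))"
    using Vx by (simp add: homeomorphic_map_interior_of[OF hom] homeomorphic_map_closure_of[OF hom]
        closure_of_subset_topspace)
  also have "\<dots> \<subseteq> X interior_of (X closure_of ((\<lambda>h. \<phi> h x) ` U))"
  proof (intro interior_of_mono closure_of_mono)
    show "\<phi> g ` (\<lambda>h. \<phi> h x) ` V \<subseteq> (\<lambda>h. \<phi> h x) ` U"
    proof clarify
      fix h assume "h \<in> V"
      then have "g \<otimes> h \<in> U" "h \<in> carrier G" by (auto simp: V_def topspace_eq)
      then show "\<phi> g (\<phi> h x) \<in> (\<lambda>h. \<phi> h x) ` U"
        using x g by (intro image_eqI[of _ _ "g \<otimes> h"]) (simp_all add: composition_rule)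
    qed
  qed
  finally show "\<phi> g x \<in> X interior_of (X closure_of ((\<lambda>h. \<phi> h x) ` U))" .
qed

text \<open>The point \<open>\<phi> h y\<close> lies in the closure of the piece \<open>U x\<close>
  of the orbit, and it has the interior of the closure of \<open>V y\<close> as an open
  neighbourhood, so \<open>U x\<close> meets that neighbourhood. The conclusion has the shape of the
  hypothesis with \<open>x\<close> and \<open>y\<close> exchanged, so the step can be
  iterated.\<close>

lemma back_and_forth_step:
  assumes "locally_somewhere_dense y"
    and y: "\<phi> h y \<in> X interior_of (X closure_of ((\<lambda>g. \<phi> g x) ` U))"
    and "openin T V" and "h \<in> V"
  obtains g where "g \<in> U" "\<phi> g x \<in> X interior_of (X closure_of ((\<lambda>h. \<phi> h y) ` V))"
proof -
  let ?O = "X interior_of (X closure_of ((\<lambda>h. \<phi> h y) ` V))"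
  have "\<phi> h y \<in> ?O" using assms by (auto simp: locally_somewhere_dense_def)
  moreover have "\<phi> h y \<in> X closure_of ((\<lambda>g. \<phi> g x) ` U)"
    using y interior_of_subset by fastforce
  ultimately obtain w where "w \<in> (\<lambda>g. \<phi> g x) ` U" "w \<in> ?O"
    using openin_interior_of[of X "X closure_of ((\<lambda>h. \<phi> h y) ` V)"]
    unfolding in_closure_of by blast
  then show thesis using that by blast
qed

end

context minimal_G_flow
begin

text \<open>Back and forth: build Cauchy sequences \<open>g n\<close> and \<open>h n\<close> in the
  group such that \<open>\<phi> (g n) x\<close> and \<open>\<phi> (h n) y\<close> come together.
  Completeness of the group supplies limits \<open>gl\<close> and \<open>hl\<close>, and continuity
  of the orbit maps gives \<open>\<phi> gl x = \<phi> hl y\<close>.\<close>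

lemma locally_somewhere_dense_same_orbit:
  assumes cmT: "completely_metrizable_space T" and mX: "metrizable_space X"
    and x: "locally_somewhere_dense x" and y: "locally_somewhere_dense y"
  shows "y \<in> orbit G \<phi> x"
proof -
  obtain A d where "Metric_space A d" and compl: "Metric_space.mcomplete A d"
    and T: "T = Metric_space.mtopology A d"
    using cmT by (auto simp: completely_metrizable_space_def)
  interpret T: Metric_space A d by fact
  obtain B e where "Metric_space B e" and X: "X = Metric_space.mtopology B e"
    using mX by (auto simp: metrizable_space_def)
  interpret X: Metric_space B e by fact
  have A: "carrier G = A" using topspace_eq T by simp
  have B: "topspace X = B" using X by simp
  have xB: "x \<in> topspace X" and yB: "y \<in> topspace X"
    using x y by (auto simp: locally_somewhere_dense_def)
  note act = action_closed[unfolded B] and xB' = xB[unfolded B] and yB' = yB[unfolded B]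
  \<comment> \<open>Each \<open>N z h n\<close> controls two distances: the one in the group makes
    the sequences Cauchy, the one in the flow keeps the orbit piece of \<open>z\<close> inside a
    small ball.\<close>
  define N where "N z h n = {g \<in> carrier G. d h g < (1/2) ^ n \<and> e (\<phi> h z) (\<phi> g z) < (1/2) ^ n}"
    for z h and n :: nat
  have N_mem: "h \<in> N z h n" if "h \<in> carrier G" "z \<in> topspace X" for z h n
    using that action_closed[OF that] unfolding B
    using A by (simp add: N_def)
  have N_open: "openin T (N z h n)" if h: "h \<in> carrier G" and z: "z \<in> topspace X" for z h n
  proof -
    have "N z h n = T.mball h ((1/2) ^ n) \<inter> {g \<in> topspace T. \<phi> g z \<in> X.mball (\<phi> h z) ((1/2) ^ n)}"
      using that action_closed unfolding N_def B topspace_eq A by auto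
    moreover have "openin T {g \<in> topspace T. \<phi> g z \<in> X.mball (\<phi> h z) ((1/2) ^ n)}"
      by (rule openin_continuous_map_preimage[OF continuous_map_action_point[OF z]]) (simp add: X)
    ultimately show ?thesis by (simp add: T openin_Int)
  qed
  define cl where "cl z U = X interior_of (X closure_of ((\<lambda>g. \<phi> g z) ` U))" for z U
  \<comment> \<open>A state is a pair \<open>(g, h)\<close>. \<open>?P\<close> is the approximation
    kept at stage \<open>n\<close>; \<open>?Q\<close> confines the next pair to the neighbourhoods
    of the current one.\<close>
  let ?P = "\<lambda>n p. fst p \<in> carrier G \<and> snd p \<in> carrier G \<and> \<phi> (snd p) y \<in> cl x (N x (fst p) n)"
  let ?Q = "\<lambda>n p q. fst q \<in> N x (fst p) n \<and> snd q \<in> N y (snd p) n"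
  have "\<exists>f. \<forall>n. ?P n (f n) \<and> ?Q n (f n) (f (Suc n))"
  proof (rule dependent_nat_choice)
    have "\<phi> \<one> x \<in> cl x (N x \<one> 0)"
      using x N_open[of \<one> x 0] N_mem[of \<one> x 0] xB
      unfolding locally_somewhere_dense_def cl_def by blast
    \<comment> \<open>Minimality enters only to start the construction: the dense orbit of
      \<open>y\<close> meets the open set \<open>cl x (N x \<one> 0)\<close>.\<close>
    moreover have "x \<in> X closure_of (orbit G \<phi> y)" using dense_orbits[OF yB] xB by simp
    ultimately obtain z where "z \<in> orbit G \<phi> y" "z \<in> cl x (N x \<one> 0)"
      using action_one[OF xB] openin_interior_of[of X] unfolding in_closure_of cl_def by auto
    then obtain h where "h \<in> carrier G" "\<phi> h y \<in> cl x (N x \<one> 0)" by (auto simp: orbit_def)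
    then show "\<exists>p. ?P 0 p" by (intro exI[of _ "(\<one>, h)"]) simp
  next
    fix p n assume p: "?P n p"
    \<comment> \<open>First a new \<open>g\<close> is chosen near the old one, aiming at the piece
      of \<open>y\<close> around the old \<open>h\<close>; then a new \<open>h\<close> is chosen in
      that piece, aiming at the smaller piece of \<open>x\<close> around the new
      \<open>g\<close>.\<close>
    obtain g where g: "g \<in> N x (fst p) n" "\<phi> g x \<in> cl y (N y (snd p) n)"
      using back_and_forth_step[OF y, of "snd p" x "N x (fst p) n" "N y (snd p) n"]
        p N_open[of "snd p" y n] N_mem[of "snd p" y n] yB unfolding cl_def by blast
    have gc: "g \<in> carrier G" using g by (simp add: N_def)
    obtain h where h: "h \<in> N y (snd p) n" "\<phi> h y \<in> cl x (N x g (Suc n))"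
      using back_and_forth_step[OF x, of g y "N y (snd p) n" "N x g (Suc n)"]
        g N_open[of g x "Suc n"] N_mem[of g x "Suc n"] xB gc unfolding cl_def by blast
    have "h \<in> carrier G" using h by (simp add: N_def)
    then show "\<exists>q. ?P (Suc n) q \<and> ?Q n p q"
      using g h gc by (intro exI[of _ "(g, h)"]) simp
  qed
  then obtain f where "\<forall>n. ?P n (f n) \<and> ?Q n (f n) (f (Suc n))" ..
  then have PQ: "?P n (f n) \<and> ?Q n (f n) (f (Suc n))" for n by (rule spec)
  define g where "g n = fst (f n)" for n
  define h where "h n = snd (f n)" for n
  have gc: "g n \<in> carrier G" and hc: "h n \<in> carrier G"
    and close: "\<phi> (h n) y \<in> cl x (N x (g n) n)"
    and gS: "g (Suc n) \<in> N x (g n) n" and hS: "h (Suc n) \<in> N y (h n) n" for n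
    using PQ[of n] by (simp_all add: g_def h_def)
  have "T.MCauchy g" "T.MCauchy h"
    using gc hc gS hS unfolding N_def A
    by (auto intro!: T.MCauchy_if_dist_Suc_less_half_power)
  then obtain gl hl where lims: "limitin T g gl sequentially" "limitin T h hl sequentially"
    using compl unfolding T.mcomplete_def T by blast
  have gl: "gl \<in> carrier G" and hl: "hl \<in> carrier G"
    using lims[THEN limitin_topspace] unfolding topspace_eq by blast+
  have lim: "limitin X (\<lambda>n. \<phi> (g n) x) (\<phi> gl x) sequentially"
      "limitin X (\<lambda>n. \<phi> (h n) y) (\<phi> hl y) sequentially"
    using continuous_map_limit[OF continuous_map_action_point[OF xB] lims(1)]
      continuous_map_limit[OF continuous_map_action_point[OF yB] lims(2)]
    unfolding o_def .
  \<comment> \<open>Closed balls are used since the point lies only in the closure of the orbit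
    piece.\<close>
  have dist: "e (\<phi> (g n) x) (\<phi> (h n) y) \<le> (1/2) ^ n" for n
  proof -
    have "\<phi> (h n) y \<in> X closure_of ((\<lambda>g. \<phi> g x) ` N x (g n) n)"
      using close[of n] interior_of_subset unfolding cl_def by fastforce
    also have "\<dots> \<subseteq> X.mcball (\<phi> (g n) x) ((1/2) ^ n)"
      using gc xB' by (intro closure_of_minimal) (auto simp: X N_def act)
    finally show ?thesis by simp
  qed
  have "limitin X (\<lambda>n. \<phi> (h n) y) (\<phi> gl x) sequentially"
    unfolding X X.limit_metric_sequentially
  proof (intro conjI allI impI)
    show "\<phi> gl x \<in> B" using gl xB' by (rule act)
    fix r :: real assume "r > 0"
    then obtain n1 where n1: "(1/2 :: real) ^ n1 < r / 2"
      using real_arch_pow_inv[of "r / 2" "1/2"] by auto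
    obtain n2 where n2: "\<And>n. n \<ge> n2 \<Longrightarrow> e (\<phi> (g n) x) (\<phi> gl x) < r / 2"
      using lim(1) \<open>r > 0\<close> unfolding X X.limit_metric_sequentially by (meson half_gt_zero)
    have "\<phi> (h n) y \<in> B \<and> e (\<phi> (h n) y) (\<phi> gl x) < r" if n: "n \<ge> max n1 n2" for n
    proof
      show hB: "\<phi> (h n) y \<in> B" using hc yB' by (rule act)
      have "(1/2 :: real) ^ n \<le> (1/2) ^ n1" using n by (intro power_decreasing) auto
      then have "e (\<phi> (h n) y) (\<phi> (g n) x) < r / 2" using dist[of n] n1 unfolding X.commute[of "\<phi> (h n) y"] by linarith
      moreover have "e (\<phi> (g n) x) (\<phi> gl x) < r / 2" using n2 n by simp
      moreover have "e (\<phi> (h n) y) (\<phi> gl x) \<le> e (\<phi> (h n) y) (\<phi> (g n) x) + e (\<phi> (g n) x) (\<phi> gl x)"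
        using hB gc gl xB' by (intro X.triangle) (auto simp: act)
      ultimately show "e (\<phi> (h n) y) (\<phi> gl x) < r" by linarith
    qed
    then show "\<exists>N. \<forall>n\<ge>N. \<phi> (h n) y \<in> B \<and> e (\<phi> (h n) y) (\<phi> gl x) < r" by blast
  qed
  then have "\<phi> hl y = \<phi> gl x"
    using lim(2) limitin_Hausdorff_unique Hausdorff by (metis trivial_limit_sequentially)
  then have "y = \<phi> (inv hl) (\<phi> gl x)" using hl yB by (metis action_inv(1))
  then have "y = \<phi> (inv hl \<otimes> gl) x" using hl gl xB by (simp add: composition_rule)
  then show ?thesis using hl gl by (auto simp: orbit_def)
qed

end

section \<open>Meagre and comeagre sets, and the Baire category theorem\<close>

lemma meagre_in_subset:
  assumes "meagre_in X B" and "A \<subseteq> B"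
  shows "meagre_in X A"
proof -
  obtain \<N> where \<N>: "countable \<N>" "\<And>N. N \<in> \<N> \<Longrightarrow> nowhere_dense_in X N" "B = \<Union>\<N>"
    using assms(1) by (auto simp: meagre_in_def)
  have "nowhere_dense_in X (N \<inter> A)" if "N \<in> \<N>" for N
  proof -
    have "X interior_of (X closure_of (N \<inter> A)) \<subseteq> X interior_of (X closure_of N)"
      by (intro interior_of_mono closure_of_mono) auto
    then show ?thesis using \<N>(2)[OF that] unfolding nowhere_dense_in_def by blast
  qed
  moreover have "A = \<Union>((\<lambda>N. N \<inter> A) ` \<N>)" using \<N>(3) assms(2) by blast
  ultimately show ?thesis
    unfolding meagre_in_def using \<N>(1) by (intro exI[of _ "(\<lambda>N. N \<inter> A) ` \<N>"]) blast
qed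

lemma comeagre_in_superset:
  assumes "comeagre_in X A" and "A \<subseteq> B" and "B \<subseteq> topspace X"
  shows "comeagre_in X B"
  using assms meagre_in_subset[of X "topspace X - A" "topspace X - B"]
  by (auto simp: comeagre_in_def)

lemma nowhere_dense_inI:
  assumes "A \<subseteq> topspace X"
    and sub: "\<And>U. openin X U \<Longrightarrow> U \<noteq> {} \<Longrightarrow> \<exists>V. openin X V \<and> V \<noteq> {} \<and> V \<subseteq> U \<and> V \<inter> A = {}"
  shows "nowhere_dense_in X A"
  unfolding nowhere_dense_in_def
proof (intro conjI assms(1), rule ccontr)
  assume "X interior_of (X closure_of A) \<noteq> {}"
  then obtain V where V: "openin X V" "V \<noteq> {}" "V \<subseteq> X interior_of (X closure_of A)" "V \<inter> A = {}"
    using sub[OF openin_interior_of] by blast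
  have "V \<inter> X closure_of A = {}" using V(1,4) by (simp add: openin_Int_closure_of_eq_empty)
  then show False using V(2,3) interior_of_subset by fastforce
qed

text \<open>Otherwise the space would be a countable union of nowhere dense sets. Their closures are
  closed with empty interior and still cover the space, which the Baire theorem for locally compact
  regular spaces forbids.\<close>

lemma comeagre_in_nonempty:
  assumes "comeagre_in X A" and "compact_space X" and "Hausdorff_space X" and "topspace X \<noteq> {}"
  shows "A \<noteq> {}"
proof
  assume "A = {}"
  then obtain \<N> where \<N>: "countable \<N>" "\<And>N. N \<in> \<N> \<Longrightarrow> nowhere_dense_in X N" "topspace X = \<Union>\<N>"
    using assms(1) by (auto simp: comeagre_in_def meagre_in_def)
  let ?\<G> = "(\<lambda>N. X closure_of N) ` \<N>"
  have "X interior_of \<Union>?\<G> = {}"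
  proof (rule Baire_category_alt)
    show "completely_metrizable_space X \<or> locally_compact_space X \<and> regular_space X"
      using assms compact_imp_locally_compact_space compact_Hausdorff_imp_regular_space by blast
  qed (use \<N> in \<open>auto simp: nowhere_dense_in_def\<close>)
  moreover have "\<Union>?\<G> = topspace X"
  proof
    show "topspace X \<subseteq> \<Union>?\<G>"
    proof
      fix x assume "x \<in> topspace X"
      then obtain N where N: "N \<in> \<N>" "x \<in> N" using \<N>(3) by blast
      then have "x \<in> X closure_of N"
        using \<N>(2)[OF N(1)] closure_of_subset[of N X] unfolding nowhere_dense_in_def by blast
      then show "x \<in> \<Union>?\<G>" using N(1) by blast
    qed
    show "\<Union>?\<G> \<subseteq> topspace X" using closure_of_subset_topspace[of X] by blast
  qed
  ultimately show False using assms(4) by simp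
qed

section \<open>Recurrent open sets and genericity of local density\<close>

context G_flow
begin

definition recurrent_for :: "'a set \<Rightarrow> 'x set \<Rightarrow> bool"
  where "recurrent_for V W \<longleftrightarrow> openin X W \<and>
    (\<forall>W1 W2. openin X W1 \<and> openin X W2 \<and> W1 \<noteq> {} \<and> W2 \<noteq> {} \<and> W1 \<subseteq> W \<and> W2 \<subseteq> W \<longrightarrow>
      (\<exists>g\<in>V. \<phi> g ` W1 \<inter> W2 \<noteq> {}))"

lemma comeagre_in_locally_somewhere_dense:
  assumes T: "metrizable_space T" and X: "second_countable X"
    and rec: "\<And>V U. openin T V \<Longrightarrow> \<one> \<in> V \<Longrightarrow> openin X U \<Longrightarrow> U \<noteq> {} \<Longrightarrow>
      \<exists>W. W \<noteq> {} \<and> W \<subseteq> U \<and> recurrent_for V W"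
  shows "comeagre_in X {x. locally_somewhere_dense x}"
proof -
  have "\<one> \<in> topspace T" by (simp add: topspace_eq)
  then obtain \<V>0 where \<V>0: "countable \<V>0" "\<And>V. V \<in> \<V>0 \<Longrightarrow> openin T V"
    "\<And>U. openin T U \<Longrightarrow> \<one> \<in> U \<Longrightarrow> \<exists>V\<in>\<V>0. \<one> \<in> V \<and> V \<subseteq> U"
    using metrizable_imp_first_countable[OF T] unfolding first_countable_def by metis
  define \<V> where "\<V> = {V \<in> \<V>0. \<one> \<in> V}"
  have \<V>: "countable \<V>" "\<And>V. V \<in> \<V> \<Longrightarrow> openin T V \<and> \<one> \<in> V"
    "\<And>U. openin T U \<Longrightarrow> \<one> \<in> U \<Longrightarrow> \<exists>V\<in>\<V>. V \<subseteq> U"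
    using \<V>0(1,2) \<V>0(3) unfolding \<V>_def by (auto, blast)
  obtain \<B> where \<B>: "countable \<B>" "\<And>B. B \<in> \<B> \<Longrightarrow> openin X B"
    "\<And>U x. openin X U \<Longrightarrow> x \<in> U \<Longrightarrow> \<exists>B\<in>\<B>. x \<in> B \<and> B \<subseteq> U"
    using X unfolding second_countable_def by metis
  \<comment> \<open>Two countable families of exceptional sets. \<open>S V\<close> holds the points
    in no recurrent basic set; \<open>R V W B\<close> holds the points of a recurrent
    \<open>W\<close> that no element of \<open>V\<close> moves into \<open>B\<close>. Off all of
    them, \<open>x\<close> lies in some recurrent basic \<open>W\<close> and \<open>V x\<close>
    meets every nonempty basic \<open>B\<close> inside \<open>W\<close>, hence is dense in
    \<open>W\<close>.\<close>
  define S where "S V = topspace X - \<Union>{W \<in> \<B>. recurrent_for V W}" for V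
  define R where "R V W B = W - {x \<in> topspace X. \<exists>g\<in>V. \<phi> g x \<in> B}" for V W B
  define I where "I = {(V, W, B) \<in> \<V> \<times> \<B> \<times> \<B>. recurrent_for V W \<and> B \<subseteq> W \<and> B \<noteq> {}}"
  define \<N> where "\<N> = S ` \<V> \<union> (\<lambda>(V, W, B). R V W B) ` I"
  have "countable I"
    using \<V>(1) \<B>(1) by (intro countable_subset[of I "\<V> \<times> \<B> \<times> \<B>"]) (auto simp: I_def)
  then have "countable \<N>" using \<V>(1) by (simp add: \<N>_def)
  have ndS: "nowhere_dense_in X (S V)" if V: "V \<in> \<V>" for V
  proof (rule nowhere_dense_inI)
    fix U assume "openin X U" "U \<noteq> {}"
    then obtain W where W: "W \<noteq> {}" "W \<subseteq> U" "recurrent_for V W"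
      using rec[of V U] \<V>(2)[OF V] by blast
    then obtain x where x: "x \<in> W" by blast
    have "openin X W" using W(3) by (simp add: recurrent_for_def)
    then obtain B where B: "x \<in> B" "B \<in> \<B>" "B \<subseteq> W" using \<B>(3) x by blast
    have Bo: "openin X B" by (rule \<B>(2)[OF B(2)])
    \<comment> \<open>Recurrence passes to open subsets, which allows the replacement of
      \<open>W\<close> by a member of the countable base.\<close>
    then have "recurrent_for V B"
      using W(3) B(3) unfolding recurrent_for_def by (meson subset_trans)
    then have "B \<inter> S V = {}" using B unfolding S_def by blast
    then show "\<exists>B. openin X B \<and> B \<noteq> {} \<and> B \<subseteq> U \<and> B \<inter> S V = {}"
      using B(1,3) W(2) Bo by blast
  qed (auto simp: S_def)
  have ndR: "nowhere_dense_in X (R V W B)" if I: "(V, W, B) \<in> I" for V W B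
  proof (rule nowhere_dense_inI)
    show "R V W B \<subseteq> topspace X"
      using I by (auto simp: R_def I_def recurrent_for_def dest: openin_subset)
    have W: "openin X W" "recurrent_for V W" "openin X B" "B \<subseteq> W" "B \<noteq> {}" and V: "openin T V"
      using I \<V>(2)[of V] \<B>(2)[of W] \<B>(2)[of B] by (auto simp: I_def)
    fix U assume U: "openin X U" "U \<noteq> {}"
    show "\<exists>U'. openin X U' \<and> U' \<noteq> {} \<and> U' \<subseteq> U \<and> U' \<inter> R V W B = {}"
    proof (cases "U \<inter> W = {}")
      case True
      then show ?thesis using U by (intro exI[of _ U]) (auto simp: R_def)
    next
      case False
      moreover have "openin X (U \<inter> W)" using U W by blast
      \<comment> \<open>Recurrence is applied to \<open>U \<inter> W\<close> and \<open>B\<close>;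
        the points of \<open>U \<inter> W\<close> sent into \<open>B\<close> by this single
        \<open>g\<close> form an open set avoiding \<open>R V W B\<close>.\<close>
      ultimately obtain g where g: "g \<in> V" "\<phi> g ` (U \<inter> W) \<inter> B \<noteq> {}"
        using W(2-5) unfolding recurrent_for_def by (meson inf_le2)
      let ?U' = "(U \<inter> W) \<inter> {x \<in> topspace X. \<phi> g x \<in> B}"
      have "g \<in> carrier G" using V g(1) in_carrier_if_openin by blast
      then have "openin X {x \<in> topspace X. \<phi> g x \<in> B}"
        using W(3) openin_continuous_map_preimage continuous_map_action by blast
      then have "openin X ?U'" using U W by blast
      moreover have "?U' \<noteq> {}" using g(2) openin_subset[OF U(1)] by blast
      moreover have "?U' \<inter> R V W B = {}" using g(1) by (auto simp: R_def)
      ultimately show ?thesis by (intro exI[of _ ?U']) blast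
    qed
  qed
  have "locally_somewhere_dense x" if x: "x \<in> topspace X" "x \<notin> \<Union>\<N>" for x
  proof (rule locally_somewhere_denseI[OF x(1)])
    fix V0 assume "openin T V0" "\<one> \<in> V0"
    then obtain V where V: "V \<in> \<V>" "V \<subseteq> V0" using \<V>(3) by blast
    then have "x \<notin> S V" using x by (auto simp: \<N>_def)
    then obtain W where W: "W \<in> \<B>" "recurrent_for V W" "x \<in> W" using x by (auto simp: S_def)
    have "W \<subseteq> X closure_of ((\<lambda>h. \<phi> h x) ` V)"
    proof
      fix z assume z: "z \<in> W"
      have Wo: "openin X W" using W \<B> by blast
      show "z \<in> X closure_of ((\<lambda>h. \<phi> h x) ` V)"
        unfolding in_closure_of
      proof (intro conjI allI impI)
        show "z \<in> topspace X" using z openin_subset[OF Wo] by blast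
        fix U assume "z \<in> U \<and> openin X U"
        then have "openin X (U \<inter> W)" "z \<in> U \<inter> W" using Wo z by auto
        then obtain B where B: "B \<in> \<B>" "z \<in> B" "B \<subseteq> U \<inter> W" using \<B>(3) by blast
        then have "(V, W, B) \<in> I" using W V by (auto simp: I_def)
        then have "R V W B \<in> \<N>" unfolding \<N>_def by force
        then have "x \<notin> R V W B" using x(2) by blast
        then have "\<exists>g\<in>V. \<phi> g x \<in> B" using W(3) x(1) by (auto simp: R_def)
        then show "\<exists>y. y \<in> (\<lambda>h. \<phi> h x) ` V \<and> y \<in> U" using B(3) by blast
      qed
    qed
    also have "\<dots> \<subseteq> X closure_of ((\<lambda>h. \<phi> h x) ` V0)"
      using V(2) by (intro closure_of_mono) blast
    finally show "x \<in> X interior_of (X closure_of ((\<lambda>h. \<phi> h x) ` V0))"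
      using W \<B>(2) by (meson interior_of_maximal subsetD)
  qed
  then have "topspace X - {x. locally_somewhere_dense x} \<subseteq> \<Union>\<N>" by blast
  moreover have "meagre_in X (\<Union>\<N>)"
    unfolding meagre_in_def using \<open>countable \<N>\<close> ndS ndR
    by (intro exI[of _ \<N>]) (auto simp: \<N>_def)
  ultimately have "meagre_in X (topspace X - {x. locally_somewhere_dense x})"
    by (rule meagre_in_subset[rotated])
  then show ?thesis unfolding comeagre_in_def locally_somewhere_dense_def by blast
qed

end

lemma (in minimal_G_flow) comeagre_orbit_if_recurrent:
  assumes T: "completely_metrizable_space T" and X: "metrizable_space X"
    and rec: "\<And>V U. openin T V \<Longrightarrow> \<one> \<in> V \<Longrightarrow> openin X U \<Longrightarrow> U \<noteq> {} \<Longrightarrow>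
      \<exists>W. W \<noteq> {} \<and> W \<subseteq> U \<and> recurrent_for V W"
  shows "\<exists>x\<in>topspace X. comeagre_in X (orbit G \<phi> x)"
proof -
  have com: "comeagre_in X {x. locally_somewhere_dense x}"
    using completely_metrizable_imp_metrizable_space[OF T]
      compact_metrizable_imp_second_countable[OF compact X] rec
    by (rule comeagre_in_locally_somewhere_dense)
  then obtain x where x: "locally_somewhere_dense x"
    using comeagre_in_nonempty[OF _ compact Hausdorff nonempty] by blast
  have xX: "x \<in> topspace X" using x by (simp add: locally_somewhere_dense_def)
  have "{y. locally_somewhere_dense y} \<subseteq> orbit G \<phi> x"
    using locally_somewhere_dense_same_orbit[OF T X x] by blast
  moreover have "orbit G \<phi> x \<subseteq> topspace X" using xX by (auto simp: orbit_def)
  ultimately show ?thesis using comeagre_in_superset[OF com] xX by blast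
qed

section \<open>Minimal subflows\<close>

text \<open>A \<open>group_action\<close> takes values in \<open>BijGroup E\<close>, whose elements
  are undefined outside \<open>E\<close>; hence the restriction of each \<open>\<psi> g\<close> to
  \<open>E\<close>.\<close>

lemma group_action_restrict:
  assumes "group G"
    and closed: "\<And>g z. g \<in> carrier G \<Longrightarrow> z \<in> E \<Longrightarrow> \<psi> g z \<in> E"
    and one: "\<And>z. z \<in> E \<Longrightarrow> \<psi> \<one>\<^bsub>G\<^esub> z = z"
    and mult: "\<And>g h z. g \<in> carrier G \<Longrightarrow> h \<in> carrier G \<Longrightarrow> z \<in> E \<Longrightarrow>
      \<psi> (g \<otimes>\<^bsub>G\<^esub> h) z = \<psi> g (\<psi> h z)"
  shows "group_action G E (\<lambda>g. \<lambda>z\<in>E. \<psi> g z)"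
proof -
  interpret group G by fact
  have bij: "(\<lambda>z\<in>E. \<psi> g z) \<in> Bij E" if g: "g \<in> carrier G" for g
  proof -
    have "bij_betw (\<psi> g) E E"
      using g closed mult one
      by (intro bij_betwI[where g = "\<psi> (inv\<^bsub>G\<^esub> g)"]) (auto simp flip: mult)
    then have "bij_betw (\<lambda>z\<in>E. \<psi> g z) E E"
      by (rule bij_betw_cong[THEN iffD1, rotated]) simp
    then show ?thesis by (simp add: Bij_def)
  qed
  show ?thesis
    unfolding group_action_def group_hom_def group_hom_axioms_def
  proof (intro conjI)
    show "(\<lambda>g. \<lambda>z\<in>E. \<psi> g z) \<in> hom G (BijGroup E)"
    proof (rule homI)
      show "(\<lambda>z\<in>E. \<psi> g z) \<in> carrier (BijGroup E)" if "g \<in> carrier G" for g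
        using bij[OF that] by (simp add: BijGroup_def)
      show "(\<lambda>z\<in>E. \<psi> (g \<otimes>\<^bsub>G\<^esub> h) z) = (\<lambda>z\<in>E. \<psi> g z) \<otimes>\<^bsub>BijGroup E\<^esub> (\<lambda>z\<in>E. \<psi> h z)"
        if "g \<in> carrier G" "h \<in> carrier G" for g h
        using that bij mult closed by (auto simp: BijGroup_def compose_def)
    qed
  qed (use is_group group_BijGroup in auto)
qed

lemma (in topological_group) G_flow_restrict:
  assumes "compact_space Z" and "Hausdorff_space Z"
    and cont: "continuous_map (prod_topology T Z) Z (\<lambda>(g, z). \<psi> g z)"
    and one: "\<And>z. z \<in> topspace Z \<Longrightarrow> \<psi> \<one> z = z"
    and mult: "\<And>g h z. g \<in> carrier G \<Longrightarrow> h \<in> carrier G \<Longrightarrow> z \<in> topspace Z \<Longrightarrow>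
      \<psi> (g \<otimes> h) z = \<psi> g (\<psi> h z)"
  shows "G_flow G T Z (\<lambda>g. \<lambda>z\<in>topspace Z. \<psi> g z)"
proof (intro G_flow.intro topological_group_axioms G_flow_axioms.intro assms(1,2)
    group_action_restrict is_group one mult)
  show "\<psi> g z \<in> topspace Z" if "g \<in> carrier G" "z \<in> topspace Z" for g z
    using continuous_map_image_subset_topspace[OF cont] that by (force simp: topspace_eq)
  show "continuous_map (prod_topology T Z) Z (\<lambda>(g, z). (\<lambda>z\<in>topspace Z. \<psi> g z) z)"
    using cont by (rule continuous_map_eq) auto
qed

context G_flow
begin

lemma orbit_subset_topspace: "x \<in> topspace X \<Longrightarrow> orbit G \<phi> x \<subseteq> topspace X"
  by (auto simp: orbit_def)

lemma orbit_closure_invariant: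
  assumes g: "g \<in> carrier G" and x: "x \<in> topspace X" and y: "y \<in> X closure_of orbit G \<phi> x"
  shows "\<phi> g y \<in> X closure_of orbit G \<phi> x"
proof -
  have "\<phi> g ` orbit G \<phi> x \<subseteq> orbit G \<phi> x"
    using g x by (force simp: orbit_def simp flip: composition_rule)
  moreover have "\<phi> g y \<in> X closure_of (\<phi> g ` orbit G \<phi> x)"
    using continuous_map_image_closure_subset[OF continuous_map_action[OF g]] y by blast
  ultimately show ?thesis using closure_of_mono by blast
qed

text \<open>Zorn's lemma is applied to the complements, the proper invariant open sets: by
  compactness the union of a chain of them is again proper. \<open>C\<close> is the complement of a
  maximal one.\<close>

lemma minimal_invariant_closed_set_exists:
  assumes "topspace X \<noteq> {}"
  obtains C where "closedin X C" "C \<noteq> {}" "\<And>g x. g \<in> carrier G \<Longrightarrow> x \<in> C \<Longrightarrow> \<phi> g x \<in> C"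
    "\<And>x. x \<in> C \<Longrightarrow> X closure_of orbit G \<phi> x = C"
proof -
  define \<U> where "\<U> = {U. openin X U \<and> U \<noteq> topspace X \<and> (\<forall>g\<in>carrier G. \<phi> g ` U \<subseteq> U)}"
  have "\<exists>U\<in>\<U>. \<forall>U'\<in>\<U>. U \<subseteq> U' \<longrightarrow> U' = U"
  proof (rule subset_Zorn_nonempty)
    have "{} \<in> \<U>" using assms openin_empty[of X] unfolding \<U>_def by blast
    then show "\<U> \<noteq> {}" by blast
  next
    fix \<C> assume ne: "\<C> \<noteq> {}" and chain: "subset.chain \<U> \<C>"
    have sub: "\<C> \<subseteq> \<U>" using chain by (simp add: subset.chain_def)
    have "\<Union>\<C> \<noteq> topspace X"
    proof
      assume eq: "\<Union>\<C> = topspace X"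
      obtain \<F> where \<F>: "finite \<F>" "\<F> \<subseteq> \<C>" "\<Union>\<F> = topspace X"
        using compact eq sub unfolding compact_space \<U>_def by (metis (lifting) mem_Collect_eq subset_iff)
      have "\<F> \<noteq> {}" using \<F>(3) assms by (metis Union_empty)
      moreover have "subset.chain \<U> \<F>" using chain \<F>(2) unfolding subset.chain_def by blast
      ultimately have "\<Union>\<F> \<in> \<F>" using \<F>(1) by (intro Union_in_chain)
      then show False using \<F> sub by (auto simp: \<U>_def)
    qed
    moreover have "openin X (\<Union>\<C>)" using sub by (intro openin_Union) (auto simp: \<U>_def)
    moreover have "\<phi> g ` \<Union>\<C> \<subseteq> \<Union>\<C>" if g: "g \<in> carrier G" for g
    proof clarify
      fix x U assume xU: "x \<in> U" "U \<in> \<C>"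
      then have "\<phi> g ` U \<subseteq> U" using sub g by (auto simp: \<U>_def)
      then show "\<phi> g x \<in> \<Union>\<C>" using xU by blast
    qed
    ultimately show "\<Union>\<C> \<in> \<U>" unfolding \<U>_def by blast
  qed
  then obtain U where U: "U \<in> \<U>" and max: "\<And>U'. U' \<in> \<U> \<Longrightarrow> U \<subseteq> U' \<Longrightarrow> U' = U" by blast
  have Ut: "U \<subseteq> topspace X" using U by (auto simp: \<U>_def dest: openin_subset)
  define C where "C = topspace X - U"
  have inv: "\<phi> g x \<in> C" if g: "g \<in> carrier G" and x: "x \<in> C" for g x
  proof -
    have "\<phi> g x \<notin> U"
    proof
      assume "\<phi> g x \<in> U"
      then have "\<phi> (inv g) (\<phi> g x) \<in> U" using U g by (auto simp: \<U>_def)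
      then show False using g x by (simp add: C_def)
    qed
    then show ?thesis using g x by (simp add: C_def)
  qed
  have closed: "closedin X C" using U by (simp add: C_def \<U>_def closedin_diff)
  have "X closure_of orbit G \<phi> x = C" if x: "x \<in> C" for x
  proof -
    let ?K = "X closure_of orbit G \<phi> x"
    have xX: "x \<in> topspace X" using x by (simp add: C_def)
    have "orbit G \<phi> x \<subseteq> C" using inv x by (auto simp: orbit_def)
    then have KC: "?K \<subseteq> C" using closed by (rule closure_of_minimal)
    have xK: "x \<in> ?K"
      using closure_of_subset[OF orbit_subset_topspace[OF xX]] orbit_refl[OF xX] by blast
    \<comment> \<open>The complement of the orbit closure is a proper invariant open set containing
      \<open>U\<close>, so maximality makes it equal to \<open>U\<close>.\<close>
    have "topspace X - ?K \<in> \<U>"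
      unfolding \<U>_def mem_Collect_eq
    proof (intro conjI ballI)
      show "openin X (topspace X - ?K)" by (simp add: openin_diff)
      have "x \<notin> topspace X - ?K" using xK by simp
      then show "topspace X - ?K \<noteq> topspace X" using xX by metis
      show "\<phi> g ` (topspace X - ?K) \<subseteq> topspace X - ?K" if g: "g \<in> carrier G" for g
      proof (rule image_subsetI)
        fix y assume y: "y \<in> topspace X - ?K"
        then have "\<phi> g y \<notin> ?K"
          using orbit_closure_invariant[OF inv_closed[OF g] xX, of "\<phi> g y"] g by auto
        then show "\<phi> g y \<in> topspace X - ?K" using g y by simp
      qed
    qed
    then have "topspace X - ?K = U" using max[of "topspace X - ?K"] KC Ut by (auto simp: C_def)
    then show ?thesis using KC closure_of_subset_topspace[of X "orbit G \<phi> x"] by (auto simp: C_def)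
  qed
  moreover have "C \<noteq> {}" using U Ut by (auto simp: C_def \<U>_def)
  ultimately show thesis using that[of C] closed inv by blast
qed

lemma minimal_subflow_exists:
  assumes "topspace X \<noteq> {}"
  obtains C where "C \<subseteq> topspace X" "minimal_G_flow G T (subtopology X C) (\<lambda>g. \<lambda>x\<in>C. \<phi> g x)"
proof -
  obtain C where C: "closedin X C" "C \<noteq> {}"
    and inv: "\<And>g x. g \<in> carrier G \<Longrightarrow> x \<in> C \<Longrightarrow> \<phi> g x \<in> C"
    and min: "\<And>x. x \<in> C \<Longrightarrow> X closure_of orbit G \<phi> x = C"
    using minimal_invariant_closed_set_exists[OF assms] by blast
  have CX: "C \<subseteq> topspace X" using C(1) closedin_subset by blast
  then have top: "topspace (subtopology X C) = C" by auto
  have "continuous_map (prod_topology T (subtopology X C)) X (\<lambda>(g, x). \<phi> g x)"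
    using continuous_map_from_subtopology[OF continuous_action, of "topspace T \<times> C"]
    by (simp flip: prod_topology_subtopology)
  then have "continuous_map (prod_topology T (subtopology X C)) (subtopology X C) (\<lambda>(g, x). \<phi> g x)"
    using inv CX by (auto simp: continuous_map_in_subtopology topspace_eq)
  moreover have "compact_space (subtopology X C)"
    using C(1) compact closedin_compact_space compact_space_subtopology by blast
  moreover have "Hausdorff_space (subtopology X C)"
    using Hausdorff Hausdorff_space_subtopology by blast
  ultimately have "G_flow G T (subtopology X C) (\<lambda>g. \<lambda>x\<in>topspace (subtopology X C). \<phi> g x)"
    using CX by (intro G_flow_restrict) (auto simp: composition_rule)
  then have "G_flow G T (subtopology X C) (\<lambda>g. \<lambda>x\<in>C. \<phi> g x)" by (simp only: top)
  moreover have "subtopology X C closure_of orbit G (\<lambda>g. \<lambda>x\<in>C. \<phi> g x) x = C" if x: "x \<in> C" for x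
  proof -
    have "orbit G (\<lambda>g. \<lambda>x\<in>C. \<phi> g x) x = orbit G \<phi> x" using x by (simp add: orbit_def)
    moreover have "orbit G \<phi> x \<subseteq> C" using inv x by (auto simp: orbit_def)
    ultimately show ?thesis using min[OF x] by (simp add: closure_of_subtopology Int_absorb1)
  qed
  ultimately have "minimal_G_flow G T (subtopology X C) (\<lambda>g. \<lambda>x\<in>C. \<phi> g x)"
    using C(2) unfolding minimal_G_flow_def minimal_G_flow_axioms_def top by blast
  then show thesis using that CX by blast
qed

end

lemma (in minimal_G_flow) invariant_closed_eq_topspace:
  assumes "closedin X C" and "C \<noteq> {}" and "\<And>g x. g \<in> carrier G \<Longrightarrow> x \<in> C \<Longrightarrow> \<phi> g x \<in> C"
  shows "C = topspace X"
proof
  show "C \<subseteq> topspace X" using assms(1) closedin_subset by blast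
  obtain x where x: "x \<in> C" using assms(2) by blast
  then have "X closure_of orbit G \<phi> x \<subseteq> C"
    using assms by (intro closure_of_minimal) (auto simp: orbit_def)
  then show "topspace X \<subseteq> C" using dense_orbits x \<open>C \<subseteq> topspace X\<close> by blast
qed

section \<open>Extending a flow with separated open sets\<close>

text \<open>Failure of recurrence inside any nonempty open \<open>W\<close> yields a pair of open
  subsets of \<open>W\<close> such that \<open>V\<close> moves no point of the first into the
  second. Keep the first as \<open>S n\<close> and choose the next pair inside the second; all later
  sets then lie in it.\<close>

lemma (in G_flow) separated_sets_if_not_recurrent:
  assumes U: "openin X U" "U \<noteq> {}"
    and nrec: "\<And>W. W \<noteq> {} \<Longrightarrow> W \<subseteq> U \<Longrightarrow> \<not> recurrent_for V W"
  obtains S :: "nat \<Rightarrow> 'x set" where "\<And>n. openin X (S n)" "\<And>n. S n \<noteq> {}"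
    "\<And>m n g. m < n \<Longrightarrow> g \<in> V \<Longrightarrow> \<phi> g ` S m \<inter> S n = {}"
proof -
  let ?R = "\<lambda>A. openin X A \<and> A \<noteq> {} \<and> A \<subseteq> U"
  let ?P = "\<lambda>(n::nat) p. ?R (fst p) \<and> ?R (snd p) \<and> (\<forall>g\<in>V. \<phi> g ` fst p \<inter> snd p = {})"
  let ?Q = "\<lambda>(n::nat) p q. fst q \<subseteq> snd p \<and> snd q \<subseteq> snd p"
  have split: "\<exists>p. ?P 0 p \<and> fst p \<subseteq> W \<and> snd p \<subseteq> W" if W: "?R W" for W
  proof -
    have "\<not> recurrent_for V W" using nrec W by blast
    then obtain W1 W2 where "openin X W1 \<and> openin X W2 \<and> W1 \<noteq> {} \<and> W2 \<noteq> {} \<and> W1 \<subseteq> W \<and> W2 \<subseteq> W"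
      "\<not> (\<exists>g\<in>V. \<phi> g ` W1 \<inter> W2 \<noteq> {})"
      using W unfolding recurrent_for_def by meson
    then show ?thesis using W by (intro exI[of _ "(W1, W2)"]) auto
  qed
  have "\<exists>f. \<forall>n. ?P n (f n) \<and> ?Q n (f n) (f (Suc n))"
  proof (rule dependent_nat_choice)
    show "\<exists>p. ?P 0 p" using split[of U] U by blast
    show "\<exists>q. ?P (Suc n) q \<and> ?Q n p q" if "?P n p" for p n
      using split[of "snd p"] that by blast
  qed
  then obtain f where "\<forall>n. ?P n (f n) \<and> ?Q n (f n) (f (Suc n))" ..
  then have PQ: "?P n (f n) \<and> ?Q n (f n) (f (Suc n))" for n by (rule spec)
  have dec: "snd (f n) \<subseteq> snd (f m)" if "m \<le> n" for m n
    using lift_Suc_antimono_le[of "\<lambda>n. snd (f n)", OF _ that] PQ by blast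
  have sub: "fst (f n) \<subseteq> snd (f m)" if mn: "m < n" for m n
  proof -
    obtain k where n: "n = Suc k" using mn by (cases n) auto
    have "fst (f n) \<subseteq> snd (f k)" using PQ[of k] by (simp add: n)
    moreover have "snd (f k) \<subseteq> snd (f m)" using mn by (intro dec) (simp add: n)
    ultimately show ?thesis by blast
  qed
  show thesis
  proof (rule that[of "\<lambda>n. fst (f n)"])
    show "openin X (fst (f n))" "fst (f n) \<noteq> {}" for n using PQ[of n] by blast+
    show "\<phi> g ` fst (f m) \<inter> fst (f n) = {}" if "m < n" "g \<in> V" for m n g
      using PQ[of m] sub[OF that(1)] that(2) by blast
  qed
qed

locale separated_flow = G_flow G T X \<phi>
  for G :: "('a, 'c) monoid_scheme" (structure) and T and X :: "'x topology" and \<phi> +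
  fixes \<rho> :: "'a \<Rightarrow> real" and S :: "nat \<Rightarrow> 'x set"
  assumes rho_nonneg: "\<And>g. g \<in> carrier G \<Longrightarrow> 0 \<le> \<rho> g"
    and rho_one: "\<rho> \<one> = 0"
    and rho_mult: "\<And>g h. g \<in> carrier G \<Longrightarrow> h \<in> carrier G \<Longrightarrow> \<rho> (g \<otimes> h) \<le> \<rho> g + \<rho> h"
    and rho_inv: "\<And>g. g \<in> carrier G \<Longrightarrow> \<rho> (inv g) = \<rho> g"
    and rho_small: "\<And>e. e > 0 \<Longrightarrow> \<exists>W. openin T W \<and> \<one> \<in> W \<and> (\<forall>g\<in>W. \<rho> g < e)"
    and open_S: "\<And>n. openin X (S n)"
    and separated: "\<And>g m n. g \<in> carrier G \<Longrightarrow> \<rho> g < 1 \<Longrightarrow> m \<noteq> n \<Longrightarrow> \<phi> g ` S m \<inter> S n = {}"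
begin

text \<open>This is the distance, measured by \<open>\<rho>\<close> along the orbit, from
  \<open>x\<close> to the union of the \<open>S n\<close> with \<open>n \<in> A\<close>, truncated
  at 1. It is shown to be Lipschitz along orbits only; continuous functions with these values come
  from the extension.\<close>

definition dist_to :: "nat set \<Rightarrow> 'x \<Rightarrow> real"
  where "dist_to A x = Inf (insert 1 {\<rho> g | g. g \<in> carrier G \<and> \<phi> g x \<in> \<Union>(S ` A)})"

lemma bdd_dist_to: "bdd_below (insert 1 {\<rho> g | g. g \<in> carrier G \<and> \<phi> g x \<in> \<Union>(S ` A)})"
  unfolding bdd_below_def using rho_nonneg by (intro exI[of _ 0]) auto

lemma dist_to_le_1: "dist_to A x \<le> 1"
  unfolding dist_to_def by (intro cInf_lower bdd_dist_to) simp

lemma dist_to_le: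
  assumes "g \<in> carrier G" and "\<phi> g x \<in> S n" and "n \<in> A"
  shows "dist_to A x \<le> \<rho> g"
  unfolding dist_to_def using assms by (intro cInf_lower bdd_dist_to) auto

lemma dist_to_greatest:
  assumes "c \<le> 1" and "\<And>g n. g \<in> carrier G \<Longrightarrow> n \<in> A \<Longrightarrow> \<phi> g x \<in> S n \<Longrightarrow> c \<le> \<rho> g"
  shows "c \<le> dist_to A x"
  unfolding dist_to_def using assms by (intro cInf_greatest) auto

lemma dist_to_nonneg: "0 \<le> dist_to A x"
  using rho_nonneg by (intro dist_to_greatest) auto

text \<open>If \<open>g\<close> moves \<open>\<phi> h x\<close> into the target, then
  \<open>g \<otimes> h\<close> moves \<open>x\<close> there, so subadditivity of
  \<open>\<rho>\<close> gives one inequality. The other is the same inequality for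
  \<open>inv h\<close> at \<open>\<phi> h x\<close>.\<close>

lemma dist_to_action:
  assumes h: "h \<in> carrier G" and x: "x \<in> topspace X"
  shows "\<bar>dist_to A (\<phi> h x) - dist_to A x\<bar> \<le> \<rho> h"
proof -
  have le: "dist_to A x - \<rho> h \<le> dist_to A (\<phi> h x)" if h: "h \<in> carrier G" and x: "x \<in> topspace X" for h x
  proof (rule dist_to_greatest)
    show "dist_to A x - \<rho> h \<le> 1" using dist_to_le_1[of A x] rho_nonneg[OF h] by simp
    fix g n assume g: "g \<in> carrier G" "n \<in> A" "\<phi> g (\<phi> h x) \<in> S n"
    then have "dist_to A x \<le> \<rho> (g \<otimes> h)"
      using h x by (intro dist_to_le[of _ _ n]) (simp_all add: composition_rule)
    then show "dist_to A x - \<rho> h \<le> \<rho> g" using rho_mult[OF g(1) h] by simp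
  qed
  have "dist_to A (\<phi> h x) - \<rho> (inv h) \<le> dist_to A (\<phi> (inv h) (\<phi> h x))"
    using h x by (intro le) simp_all
  then show ?thesis using le[OF h x] h x by (simp add: rho_inv abs_le_iff)
qed

lemma dist_to_eq:
  assumes "x \<in> S n"
  shows "dist_to A x = (if n \<in> A then 0 else 1)"
proof -
  have x: "x \<in> topspace X" using assms openin_subset[OF open_S] by blast
  show ?thesis
  proof (cases "n \<in> A")
    case True
    then have "dist_to A x \<le> 0" using dist_to_le[of \<one> x n A] assms x by (simp add: rho_one)
    then show ?thesis using True dist_to_nonneg[of A x] by simp
  next
    case False
    have "1 \<le> dist_to A x"
    proof (rule dist_to_greatest)
      fix g m assume g: "g \<in> carrier G" "m \<in> A" "\<phi> g x \<in> S m"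
      then have "\<phi> g ` S n \<inter> S m \<noteq> {}" using assms by blast
      then show "1 \<le> \<rho> g" using separated[of g n m] g False by (metis not_le)
    qed simp
    then show ?thesis using False dist_to_le_1[of A x] by simp
  qed
qed

section \<open>The extension as a compact flow\<close>

definition index :: "('a \<times> nat set) set"
  where "index = carrier G \<times> UNIV"

definition ambient :: "('x \<times> ('a \<times> nat set \<Rightarrow> real)) topology"
  where "ambient = prod_topology X (product_topology (\<lambda>_. top_of_set {0..1}) index)"

text \<open>
  For a point \<open>(x, y)\<close> think of \<open>y (g, A)\<close> as the value at \<open>\<phi> g x\<close> of a function that is \<open>1\<close> on
  \<open>S n\<close> for \<open>n \<in> A\<close> and \<open>0\<close> on \<open>S n\<close> for \<open>n \<notin> A\<close>.  The Lipschitz condition makes the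
  action on the product jointly continuous, and the condition on \<open>S n\<close> is closed because \<open>S n\<close>
  is open.
\<close>

definition points :: "('x \<times> ('a \<times> nat set \<Rightarrow> real)) set"
  where "points = {p \<in> topspace ambient.
    (\<forall>g\<in>carrier G. \<forall>h\<in>carrier G. \<forall>A. \<bar>snd p (h \<otimes> g, A) - snd p (g, A)\<bar> \<le> \<rho> h) \<and>
    (\<forall>g\<in>carrier G. \<forall>A n. \<phi> g (fst p) \<in> S n \<longrightarrow> snd p (g, A) = (if n \<in> A then 1 else 0))}"

definition extension :: "('x \<times> ('a \<times> nat set \<Rightarrow> real)) topology"
  where "extension = subtopology ambient points"

text \<open>The coordinate \<open>(g, A)\<close> records a value at \<open>\<phi> g x\<close>. Over
  the base point \<open>\<phi> k x\<close> it must therefore read the old coordinate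
  \<open>(g \<otimes> k, A)\<close>.\<close>

definition shift :: "'a \<Rightarrow> 'x \<times> ('a \<times> nat set \<Rightarrow> real) \<Rightarrow> 'x \<times> ('a \<times> nat set \<Rightarrow> real)"
  where "shift k p = (\<phi> k (fst p), \<lambda>i\<in>index. snd p (fst i \<otimes> k, snd i))"

lemma topspace_ambient: "topspace ambient = topspace X \<times> (index \<rightarrow>\<^sub>E {0..1})"
  by (simp add: ambient_def)

lemma topspace_extension: "topspace extension = points"
  by (auto simp: extension_def points_def)

lemma continuous_map_ambient_fst: "continuous_map ambient X fst"
  by (simp add: ambient_def continuous_map_fst)

lemma continuous_map_ambient_coordinate:
  assumes "g \<in> carrier G"
  shows "continuous_map ambient euclideanreal (\<lambda>p. snd p (g, A))"
proof -
  have "(g, A) \<in> index" using assms by (simp add: index_def)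
  then have "continuous_map ambient (top_of_set {0..1::real}) (\<lambda>p. snd p (g, A))"
    unfolding ambient_def
    using continuous_map_compose[OF continuous_map_snd continuous_map_product_projection]
    by (fastforce simp: o_def)
  then show ?thesis by (rule continuous_map_into_fulltopology)
qed

lemma closedin_points: "closedin ambient points"
proof -
  define L where "L = (\<lambda>(g, h, A). {p \<in> topspace ambient. snd p (h \<otimes> g, A) - snd p (g, A) \<in> cball 0 (\<rho> h)})"
  \<comment> \<open>The implication defining \<open>points\<close> is rewritten as a union of two
    closed conditions; the first is closed because \<open>S n\<close> is open.\<close>
  define E where "E = (\<lambda>(g, A, n). {p \<in> topspace ambient. \<phi> g (fst p) \<in> topspace X - S n} \<union>
    {p \<in> topspace ambient. snd p (g, A) \<in> {if n \<in> A then 1 else 0}})"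
  have L: "closedin ambient (L i)" if I: "i \<in> carrier G \<times> carrier G \<times> UNIV" for i
  proof -
    obtain g h A where i: "i = (g, h, A)" "g \<in> carrier G" "h \<in> carrier G" using I by auto
    have "continuous_map ambient euclideanreal (\<lambda>p. snd p (h \<otimes> g, A) - snd p (g, A))"
      using i by (intro continuous_map_diff continuous_map_ambient_coordinate) auto
    from closedin_continuous_map_preimage[OF this, of "cball 0 (\<rho> h)"]
    show ?thesis by (simp add: L_def i)
  qed
  have E: "closedin ambient (E i)" if I: "i \<in> carrier G \<times> UNIV \<times> UNIV" for i
  proof -
    obtain g A n where i: "i = (g, A, n)" "g \<in> carrier G" using I by auto
    have c: "continuous_map ambient X (\<lambda>p. \<phi> g (fst p))"
      using continuous_map_compose[OF continuous_map_ambient_fst continuous_map_action[OF i(2)]]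
      by (simp add: o_def)
    have "closedin X (topspace X - S n)" using open_S by blast
    from closedin_continuous_map_preimage[OF c this]
      closedin_continuous_map_preimage[OF continuous_map_ambient_coordinate[OF i(2), of A],
        of "{if n \<in> A then 1 else 0}"]
    show ?thesis unfolding E_def i by (auto intro: closedin_Un)
  qed
  let ?F = "insert (topspace ambient)
    (L ` (carrier G \<times> carrier G \<times> UNIV) \<union> E ` (carrier G \<times> UNIV \<times> UNIV))"
  have "closedin ambient (\<Inter>?F)"
    using L E by (intro closedin_Inter) auto
  moreover have "points = \<Inter>?F"
  proof (intro equalityI subsetI)
    fix p assume "p \<in> points"
    then show "p \<in> \<Inter>?F"
      by (auto simp: points_def L_def E_def topspace_ambient)
  next
    fix p assume p: "p \<in> \<Inter>?F"
    then have pt: "p \<in> topspace ambient" by (rule InterD) (rule insertI1)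
    show "p \<in> points"
      unfolding points_def
    proof (intro CollectI conjI ballI allI impI pt)
      fix g h A assume g: "g \<in> carrier G" "h \<in> carrier G"
      have "p \<in> L (g, h, A)"
        by (rule InterD[OF p], rule insertI2, rule UnI1, rule imageI) (simp add: g)
      then show "\<bar>snd p (h \<otimes> g, A) - snd p (g, A)\<bar> \<le> \<rho> h" by (simp add: L_def)
    next
      fix g A n assume g: "g \<in> carrier G" "\<phi> g (fst p) \<in> S n"
      have "p \<in> E (g, A, n)"
        by (rule InterD[OF p], rule insertI2, rule UnI2, rule imageI) (simp add: g)
      then show "snd p (g, A) = (if n \<in> A then 1 else 0)" using g(2) by (auto simp: E_def)
    qed
  qed
  ultimately show ?thesis by simp
qed

lemma compact_extension: "compact_space extension"
proof -
  have "compact_space ambient"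
    unfolding ambient_def by (auto simp: compact_space_prod_topology compact_space_product_topology compact compact_space_subtopology)
  then show ?thesis
    unfolding extension_def
    using closedin_points closedin_compact_space compact_space_subtopology by blast
qed

lemma Hausdorff_extension: "Hausdorff_space extension"
  unfolding extension_def ambient_def
  by (intro Hausdorff_space_subtopology)
    (auto simp: Hausdorff_space_prod_topology Hausdorff_space_product_topology Hausdorff
      Hausdorff_space_subtopology)

text \<open>Right translation of indices commutes with left multiplication, so each condition at
  \<open>g\<close> for the shifted point is the condition at \<open>g \<otimes> k\<close> for the
  original one.\<close>

lemma shift_in_points:
  assumes k: "k \<in> carrier G" and p: "p \<in> points"
  shows "shift k p \<in> points"
proof -
  have p1: "fst p \<in> topspace X" and p2: "snd p \<in> index \<rightarrow>\<^sub>E {0..1}"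
    and lip: "\<And>g h A. g \<in> carrier G \<Longrightarrow> h \<in> carrier G \<Longrightarrow> \<bar>snd p (h \<otimes> g, A) - snd p (g, A)\<bar> \<le> \<rho> h"
    and val: "\<And>g A n. g \<in> carrier G \<Longrightarrow> \<phi> g (fst p) \<in> S n \<Longrightarrow> snd p (g, A) = (if n \<in> A then 1 else 0)"
    using p by (auto simp: points_def topspace_ambient)
  show ?thesis
    unfolding points_def
  proof (intro CollectI conjI ballI allI impI)
    have "snd p (fst i \<otimes> k, snd i) \<in> {0..1}" if "i \<in> index" for i
      using that k by (intro PiE_mem[OF p2]) (auto simp: index_def)
    then show "shift k p \<in> topspace ambient"
      using p1 k by (auto simp: topspace_ambient shift_def)
    show "\<bar>snd (shift k p) (h \<otimes> g, A) - snd (shift k p) (g, A)\<bar> \<le> \<rho> h"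
      if "g \<in> carrier G" "h \<in> carrier G" for g h A
      using that k lip[of "g \<otimes> k" h A] by (simp add: shift_def index_def m_assoc)
    show "snd (shift k p) (g, A) = (if n \<in> A then 1 else 0)"
      if "g \<in> carrier G" "\<phi> g (fst (shift k p)) \<in> S n" for g A n
      using that k val[of "g \<otimes> k" n A] p1 by (simp add: shift_def index_def composition_rule)
  qed
qed

text \<open>Varying \<open>k\<close> moves the index, which the Lipschitz condition controls
  uniformly in \<open>p\<close>; varying \<open>p\<close> at the fixed index
  \<open>g \<otimes> k0\<close> is continuity of one coordinate. Each change gets half of
  \<open>e\<close>.\<close>

lemma continuous_map_evaluation:
  assumes g: "g \<in> carrier G"
  shows "continuous_map (prod_topology T extension) euclideanreal (\<lambda>(k, p). snd p (g \<otimes> k, A))"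
proof -
  have "continuous_map (prod_topology T extension) Met_TC.mtopology (\<lambda>(k, p). snd p (g \<otimes> k, A))"
    unfolding Met_TC.continuous_map_to_metric
  proof (intro ballI allI impI)
    fix q :: "'a \<times> ('x \<times> ('a \<times> nat set \<Rightarrow> real))" and e :: real
    assume "q \<in> topspace (prod_topology T extension)" and e: "e > 0"
    then obtain k0 p0 where q: "q = (k0, p0)" "k0 \<in> carrier G" "p0 \<in> points"
      by (auto simp: topspace_eq topspace_extension)
    have gk0: "g \<otimes> k0 \<in> carrier G" using g q by simp
    obtain W where W: "openin T W" "\<one> \<in> W" "\<And>h. h \<in> W \<Longrightarrow> \<rho> h < e / 2"
      using rho_small[of "e / 2"] e by auto
    \<comment> \<open>This element \<open>h\<close> satisfies
      \<open>h \<otimes> (g \<otimes> k0) = g \<otimes> k\<close>, the form required by the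
      Lipschitz condition.\<close>
    have "continuous_map T T (\<lambda>k. g \<otimes> k \<otimes> inv (g \<otimes> k0))"
      using continuous_map_compose[OF continuous_map_translation_left[OF g]
          continuous_map_translation_right, of "inv (g \<otimes> k0)"] gk0
      by (simp add: o_def)
    from openin_continuous_map_preimage[OF this W(1)]
    have K: "openin T {k \<in> topspace T. g \<otimes> k \<otimes> inv (g \<otimes> k0) \<in> W}" (is "openin T ?K") .
    have "continuous_map extension euclideanreal (\<lambda>p. snd p (g \<otimes> k0, A))"
      unfolding extension_def
      by (intro continuous_map_from_subtopology continuous_map_ambient_coordinate gk0)
    from openin_continuous_map_preimage[OF this, of "ball (snd p0 (g \<otimes> k0, A)) (e / 2)"]
    have B: "openin extension {p \<in> topspace extension. snd p (g \<otimes> k0, A) \<in> ball (snd p0 (g \<otimes> k0, A)) (e / 2)}"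
      (is "openin _ ?B") by simp
    have "openin (prod_topology T extension) (?K \<times> ?B)"
      using K B by (simp add: openin_prod_Times_iff)
    moreover have "q \<in> ?K \<times> ?B"
      using q W(2) e gk0 by (simp add: topspace_eq topspace_extension)
    moreover have "(case r of (k, p) \<Rightarrow> snd p (g \<otimes> k, A))
        \<in> Met_TC.mball (case q of (k, p) \<Rightarrow> snd p (g \<otimes> k, A)) e" if "r \<in> ?K \<times> ?B" for r
    proof -
      obtain k p where r: "r = (k, p)" "k \<in> carrier G" "g \<otimes> k \<otimes> inv (g \<otimes> k0) \<in> W" "p \<in> points"
        "snd p (g \<otimes> k0, A) \<in> ball (snd p0 (g \<otimes> k0, A)) (e / 2)"
        using \<open>r \<in> ?K \<times> ?B\<close> by (auto simp: topspace_eq topspace_extension)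
      let ?h = "g \<otimes> k \<otimes> inv (g \<otimes> k0)"
      have h: "?h \<in> carrier G" "?h \<otimes> (g \<otimes> k0) = g \<otimes> k"
        using g q r gk0 by (simp_all add: m_assoc)
      have "\<bar>snd p (?h \<otimes> (g \<otimes> k0), A) - snd p (g \<otimes> k0, A)\<bar> \<le> \<rho> ?h"
        using r(4) h(1) gk0 unfolding points_def by blast
      then have "\<bar>snd p (g \<otimes> k, A) - snd p (g \<otimes> k0, A)\<bar> < e / 2" using h(2) W(3)[OF r(3)] by simp
      moreover have "\<bar>snd p0 (g \<otimes> k0, A) - snd p (g \<otimes> k0, A)\<bar> < e / 2"
        using r(5) by (simp add: dist_real_def)
      ultimately have "\<bar>snd p0 (g \<otimes> k0, A) - snd p (g \<otimes> k, A)\<bar> < e" by linarith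
      then show ?thesis using q r(1) by (simp add: dist_real_def)
    qed
    ultimately show "\<exists>U. openin (prod_topology T extension) U \<and> q \<in> U \<and>
        (\<forall>r\<in>U. (case r of (k, p) \<Rightarrow> snd p (g \<otimes> k, A))
          \<in> Met_TC.mball (case q of (k, p) \<Rightarrow> snd p (g \<otimes> k, A)) e)"
      by blast
  qed
  then show ?thesis by simp
qed

lemma continuous_map_shift:
  "continuous_map (prod_topology T extension) extension (\<lambda>(k, p). shift k p)"
proof -
  let ?P = "prod_topology T extension"
  have top: "topspace ?P = carrier G \<times> points" by (simp add: topspace_eq topspace_extension)
  have "continuous_map ?P X (\<lambda>(k, p). \<phi> k (fst p))"
  proof -
    have "continuous_map extension X fst"
      unfolding extension_def by (rule continuous_map_from_subtopology[OF continuous_map_ambient_fst])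
    then have "continuous_map ?P (prod_topology T X) (\<lambda>(k, p). (k, fst p))"
      using continuous_map_prod_top[of T extension T X "\<lambda>k. k" fst] by simp
    from continuous_map_compose[OF this continuous_action] show ?thesis
      by (simp add: o_def case_prod_unfold)
  qed
  moreover have "continuous_map ?P (product_topology (\<lambda>_. top_of_set {0..1}) index)
      (\<lambda>(k, p). \<lambda>i\<in>index. snd p (fst i \<otimes> k, snd i))"
    unfolding continuous_map_componentwise
  proof (intro conjI ballI)
    fix i assume i: "i \<in> index"
    then have c: "continuous_map ?P euclideanreal (\<lambda>(k, p). snd p (fst i \<otimes> k, snd i))"
      by (intro continuous_map_evaluation) (auto simp: index_def)
    have "snd p (fst i \<otimes> k, snd i) \<in> {0..1}" if "k \<in> carrier G" "p \<in> points" for k p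
    proof -
      have "snd p \<in> index \<rightarrow>\<^sub>E {0..1}" using that by (auto simp: points_def topspace_ambient)
      from PiE_mem[OF this] show ?thesis using that i by (simp add: index_def mem_Times_iff)
    qed
    then show "continuous_map ?P (top_of_set {0..1})
        (\<lambda>q. (case q of (k, p) \<Rightarrow> \<lambda>i\<in>index. snd p (fst i \<otimes> k, snd i)) i)"
      using c i
      by (simp add: continuous_map_in_subtopology case_prod_unfold top Pi_iff image_subset_iff
          topspace_eq topspace_extension)
  qed (auto simp: case_prod_beta)
  ultimately have "continuous_map ?P ambient (\<lambda>(k, p). shift k p)"
    unfolding ambient_def continuous_map_pairwise
    by (simp add: o_def case_prod_unfold shift_def)
  then have "continuous_map ?P (subtopology ambient points) (\<lambda>(k, p). shift k p)"
    by (rule continuous_map_into_subtopology) (auto simp: topspace_eq topspace_extension intro: shift_in_points)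
  then show ?thesis by (simp only: flip: extension_def)
qed

lemma extension_G_flow: "G_flow G T extension (\<lambda>k. \<lambda>p\<in>topspace extension. shift k p)"
proof (rule G_flow_restrict[OF compact_extension Hausdorff_extension continuous_map_shift])
  fix p assume "p \<in> topspace extension"
  then have p: "fst p \<in> topspace X" "snd p \<in> index \<rightarrow>\<^sub>E {0..1}"
    by (auto simp: topspace_extension points_def topspace_ambient)
  show "shift \<one> p = p"
    using p by (auto simp: shift_def index_def prod_eq_iff fun_eq_iff restrict_def PiE_def extensional_def)
  show "shift (g \<otimes> h) p = shift g (shift h p)" if "g \<in> carrier G" "h \<in> carrier G" for g h
    using p(1) that by (auto simp: shift_def index_def fun_eq_iff restrict_def composition_rule m_assoc)
qed

lemma extension_nonempty:
  assumes "topspace X \<noteq> {}"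
  shows "topspace extension \<noteq> {}"
proof -
  obtain x where x: "x \<in> topspace X" using assms by blast
  \<comment> \<open>A point over \<open>x\<close>: the functions \<open>1 - dist_to A\<close>, read
    along the orbit of \<open>x\<close>. The reversal gives 1 on \<open>S n\<close> for
    \<open>n \<in> A\<close>.\<close>
  define y where "y = (\<lambda>i\<in>index. 1 - dist_to (snd i) (\<phi> (fst i) x))"
  have "(x, y) \<in> points"
    unfolding points_def
  proof (intro CollectI conjI ballI allI impI)
    show "(x, y) \<in> topspace ambient"
      using x dist_to_nonneg dist_to_le_1 by (auto simp: topspace_ambient y_def)
    show "\<bar>snd (x, y) (h \<otimes> g, A) - snd (x, y) (g, A)\<bar> \<le> \<rho> h"
      if "g \<in> carrier G" "h \<in> carrier G" for g h A
      using dist_to_action[OF that(2), of "\<phi> g x" A] that x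
      by (simp add: y_def index_def composition_rule abs_minus_commute)
    show "snd (x, y) (g, A) = (if n \<in> A then 1 else 0)"
      if "g \<in> carrier G" "\<phi> g (fst (x, y)) \<in> S n" for g A n
      using that dist_to_eq[of "\<phi> g x" n A] by (simp add: y_def index_def)
  qed
  then show ?thesis by (auto simp: topspace_extension)
qed

lemma extension_coordinate:
  assumes "p \<in> topspace extension" and "fst p \<in> S n"
  shows "snd p (\<one>, A) = (if n \<in> A then 1 else 0)"
proof -
  have "fst p \<in> topspace X" using assms(2) openin_subset[OF open_S] by blast
  then show ?thesis using assms by (simp add: topspace_extension points_def)
qed

end

section \<open>The extension contradicts metrizability\<close>

lemma not_convergent_alternating:
  "\<not> (\<lambda>n. if even n then 1 else 0 :: real) \<longlonglongrightarrow> l"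
proof
  assume lim: "(\<lambda>n. if even n then 1 else 0 :: real) \<longlonglongrightarrow> l"
  have "strict_mono (\<lambda>n::nat. 2 * n)" "strict_mono (\<lambda>n::nat. 2 * n + 1)"
    by (simp_all add: strict_mono_def)
  from this[THEN LIMSEQ_subseq_LIMSEQ[OF lim]]
  have "(\<lambda>n. 1 :: real) \<longlonglongrightarrow> l" "(\<lambda>n. 0 :: real) \<longlonglongrightarrow> l" by (simp_all add: o_def)
  then show False by (metis LIMSEQ_unique tendsto_const zero_neq_one)
qed

lemma (in separated_flow) no_factor_map_onto_extensions:
  assumes min: "minimal_G_flow G T X \<phi>" and metrizable: "metrizable_space X"
    and S_nonempty: "\<And>n. S n \<noteq> {}"
    and factor: "\<And>(Y :: ('x \<times> ('a \<times> nat set \<Rightarrow> real)) topology) \<psi>.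
      minimal_G_flow G T Y \<psi> \<Longrightarrow> \<exists>f. G_factor_map G X \<phi> Y \<psi> f"
  shows False
proof -
  interpret minimal_G_flow G T X \<phi> by fact
  interpret ext: G_flow G T extension "\<lambda>k. \<lambda>p\<in>topspace extension. shift k p"
    by (rule extension_G_flow)
  obtain C where C: "C \<subseteq> topspace extension" and Cmin: "minimal_G_flow G T (subtopology extension C)
      (\<lambda>k. \<lambda>p\<in>C. (\<lambda>p\<in>topspace extension. shift k p) p)"
    using ext.minimal_subflow_exists[OF extension_nonempty[OF nonempty]] by blast
  interpret C: minimal_G_flow G T "subtopology extension C"
    "\<lambda>k. \<lambda>p\<in>C. (\<lambda>p\<in>topspace extension. shift k p) p" by fact
  have top: "topspace (subtopology extension C) = C" using C by auto
  obtain f where "G_factor_map G X \<phi> (subtopology extension C)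
      (\<lambda>k. \<lambda>p\<in>C. (\<lambda>p\<in>topspace extension. shift k p) p) f"
    using factor[OF Cmin] by blast
  then have f: "continuous_map X (subtopology extension C) f" and f_onto: "f ` topspace X = C"
    unfolding G_factor_map_def top by blast+
  have fC: "f x \<in> C" if "x \<in> topspace X" for x using f_onto that by blast
  \<comment> \<open>The base projection of the minimal subflow is nonempty, closed and invariant, so
    minimality of the base makes it everything.\<close>
  have "fst ` C = topspace X"
  proof (rule invariant_closed_eq_topspace)
    have "continuous_map (subtopology extension C) X fst"
      unfolding extension_def
      by (intro continuous_map_from_subtopology continuous_map_ambient_fst)
    moreover have "compactin (subtopology extension C) C" using C.compact top by (simp add: compact_space_def)
    ultimately show "closedin X (fst ` C)"
      using Hausdorff compactin_imp_closedin image_compactin by blast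
    show "fst ` C \<noteq> {}" using C.nonempty top by blast
    fix g x assume g: "g \<in> carrier G" and "x \<in> fst ` C"
    then obtain p where p: "p \<in> C" "x = fst p" by blast
    have "shift g p \<in> C" using C.action_closed[OF g, of p] p(1) subsetD[OF C p(1)] unfolding top by simp
    then show "\<phi> g x \<in> fst ` C" using p(2) by (force simp: shift_def)
  qed
  then have onto: "fst ` f ` topspace X = topspace X" by (simp only: f_onto)
  have "\<exists>x. x \<in> topspace X \<and> fst (f x) \<in> S n" for n
  proof -
    obtain y where y: "y \<in> S n" using S_nonempty[of n] by blast
    then have "y \<in> fst ` f ` topspace X" unfolding onto using openin_subset[OF open_S] by blast
    then show ?thesis using y by blast
  qed
  \<comment> \<open>The composite of \<open>fst\<close> with \<open>f\<close> is not known to be the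
    identity, so \<open>q n\<close> is chosen as a preimage of a point of \<open>S n\<close> under
    it.\<close>
  then obtain q where q: "\<And>n. q n \<in> topspace X" "\<And>n. fst (f (q n)) \<in> S n" by metis
  obtain M d where "Metric_space M d" and X: "X = Metric_space.mtopology M d"
    using metrizable by (auto simp: metrizable_space_def)
  interpret Metric_space M d by fact
  have "range q \<subseteq> M" using q(1) X by auto
  then obtain l r where r: "strict_mono r" and lim: "limitin X (q \<circ> r) l sequentially"
    using compact unfolding X compact_space_sequentially by blast
  \<comment> \<open>\<open>A\<close> is read off the convergent subsequence, which is why the
    extension carries a coordinate for every set of naturals at once.\<close>
  define A where "A = r ` {n. even n}"
  have "continuous_map extension euclideanreal (\<lambda>p. snd p (\<one>, A))"
    unfolding extension_def
    by (intro continuous_map_from_subtopology continuous_map_ambient_coordinate) simp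
  then have "continuous_map X euclideanreal ((\<lambda>p. snd p (\<one>, A)) \<circ> f)"
    by (intro continuous_map_compose[OF f] continuous_map_from_subtopology)
  from continuous_map_limit[OF this lim]
  have "(\<lambda>n. snd (f (q (r n))) (\<one>, A)) \<longlonglongrightarrow> snd (f l) (\<one>, A)" by (simp add: o_def)
  moreover have "snd (f (q (r n))) (\<one>, A) = (if even n then 1 else 0)" for n
  proof -
    have "f (q (r n)) \<in> topspace extension" using fC q(1) C by blast
    then have "snd (f (q (r n))) (\<one>, A) = (if r n \<in> A then 1 else 0)"
      using q(2) by (rule extension_coordinate)
    moreover have "r n \<in> A \<longleftrightarrow> even n"
      using strict_mono_eq[OF r] by (auto simp: A_def)
    ultimately show ?thesis by simp
  qed
  ultimately show False using not_convergent_alternating by simp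
qed

section \<open>Application to the universal minimal flow\<close>

lemma universal_minimal_flow_recurrent:
  fixes G :: "('g, 'c) monoid_scheme" and M :: "'x topology"
  assumes umf: "universal_minimal_flow G T M \<phi>"
    and metrizable: "metrizable_space M"
    and V: "openin T V" "\<one>\<^bsub>G\<^esub> \<in> V" and U: "openin M U" "U \<noteq> {}"
  shows "\<exists>W. W \<noteq> {} \<and> W \<subseteq> U \<and> G_flow.recurrent_for M \<phi> V W"
proof (rule ccontr)
  have min: "minimal_G_flow G T M \<phi>" using umf by (simp add: universal_minimal_flow_def)
  interpret minimal_G_flow G T M \<phi> by (rule min)
  assume "\<not> ?thesis"
  then obtain S :: "nat \<Rightarrow> 'x set" where S: "\<And>n. openin M (S n)" "\<And>n. S n \<noteq> {}"
    and sep: "\<And>m n g. m < n \<Longrightarrow> g \<in> V \<Longrightarrow> \<phi> g ` S m \<inter> S n = {}"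
    using separated_sets_if_not_recurrent[OF U, of V] by metis
  obtain \<rho> :: "'g \<Rightarrow> real" where \<rho>: "\<And>g. g \<in> carrier G \<Longrightarrow> 0 \<le> \<rho> g" "\<rho> \<one>\<^bsub>G\<^esub> = 0"
    "\<And>g h. g \<in> carrier G \<Longrightarrow> h \<in> carrier G \<Longrightarrow> \<rho> (g \<otimes>\<^bsub>G\<^esub> h) \<le> \<rho> g + \<rho> h"
    "\<And>g. g \<in> carrier G \<Longrightarrow> \<rho> (inv\<^bsub>G\<^esub> g) = \<rho> g"
    "\<And>e. e > 0 \<Longrightarrow> \<exists>W. openin T W \<and> \<one>\<^bsub>G\<^esub> \<in> W \<and> (\<forall>g\<in>W. \<rho> g < e)"
    and \<rho>V: "\<And>g. g \<in> carrier G \<Longrightarrow> \<rho> g < 1 \<Longrightarrow> g \<in> V"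
    using Birkhoff_Kakutani_length_function[OF V] by blast
  \<comment> \<open>The construction separates \<open>S m\<close> from \<open>S n\<close> only for
    \<open>m < n\<close>. The symmetry of \<open>\<rho>\<close> puts \<open>inv g\<close> in
    \<open>V\<close> too, and this supplies the other order.\<close>
  have "\<phi> g ` S m \<inter> S n = {}" if g: "g \<in> carrier G" "\<rho> g < 1" and "m \<noteq> n" for g m n
  proof (cases "m < n")
    case True
    then show ?thesis using sep \<rho>V[OF g] by blast
  next
    case False
    then have "n < m" using \<open>m \<noteq> n\<close> by simp
    moreover have "inv\<^bsub>G\<^esub> g \<in> V" using g \<rho>(4) by (intro \<rho>V) simp_all
    ultimately have disj: "\<phi> (inv\<^bsub>G\<^esub> g) ` S n \<inter> S m = {}" by (rule sep)
    show ?thesis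
    proof (rule ccontr)
      assume "\<phi> g ` S m \<inter> S n \<noteq> {}"
      then obtain x where x: "x \<in> S m" "\<phi> g x \<in> S n" by blast
      then have "x \<in> topspace M" using openin_subset[OF S(1)] by blast
      then have "\<phi> (inv\<^bsub>G\<^esub> g) (\<phi> g x) = x" using g by simp
      then show False using disj x by force
    qed
  qed
  then interpret separated_flow G T M \<phi> \<rho> S
    using \<rho> S(1) by unfold_locales auto
  show False
    \<comment> \<open>The extension does not have its points in \<open>'g set set\<close>, so the
      universal property is taken in its form for target flows on arbitrary types.\<close>
    using min metrizable S(2) universal_minimal_flow_maps_onto[OF umf]
    by (rule no_factor_map_onto_extensions)
qed

theorem theorem1p2:
  fixes G :: "('g, 'c) monoid_scheme" and T :: "'g topology"
    and M :: "'x topology" and \<phi> :: "'g \<Rightarrow> 'x \<Rightarrow> 'x"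
  assumes "Polish_group G T"
    and "universal_minimal_flow G T M \<phi>"
    and "metrizable_space M"
  shows "\<exists>x\<in>topspace M. comeagre_in M (orbit G \<phi> x)"
proof -
  interpret Polish_group G T by fact
  interpret minimal_G_flow G T M \<phi>
    using assms(2) by (simp add: universal_minimal_flow_def)
  show ?thesis
    using completely_metrizable assms(3) universal_minimal_flow_recurrent[OF assms(2,3)]
    by (rule comeagre_orbit_if_recurrent)
qed

end
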